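(* Let $M$ be a two-player zero-sum Markov game in the decoupled setting, and let $\mathcal F\subset\mathcal G$ be classes of action-value functions such that $\mathcal T_h\mathcal F_{h+1}\subseteq\mathcal G_h$ for all $h$. Put $\eta_h=\{s_h,a_h,b_h\}$, $\zeta_h=\{s_{h+1}\}$, $\kappa=1$, $d=d_{\mathrm{ME}}(\mathcal F,1/\sqrt K)$ (the minimax BE dimension) and $$\ell_{h,f'}(\zeta_h,\eta_h,f,g)=Q_{h,g}(s_h,a_h,b_h)-r_h(s_h,a_h,b_h)-V_{h+1,f}(s_{h+1}),\qquad V_{h+1,f}(s)=\max_\upsilon\min_\mu Q_{h+1,f}(s,\upsilon,\mu).$$ Then $(M,\mathcal F,\mathcal G,\ell,d,\kappa)$ is an $\ell_2$-type EC class, and $\ell$ is decomposable with the MG Bellman operator $\mathcal T$. In particular, for each $h\in[H]$ and $\beta\ge R^2$: if $\sum_{i=1}^{k-1}\mathcal E_h(f^k,s_h^i,a_h^i,b_h^i)^2\le\beta$ for all $k\in[K]$, then for all $k\in[K]$ $$\sum_{i=1}^k\mathcal E_h(f^i,s_h^i,a_h^i,b_h^i)^2\le\mathcal O(d\beta\log K).$$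
   Context: **Model.** A two-player zero-sum Markov game $(\mathcal S,\mathcal A,\mathcal B,H,\mathbb P,r)$ has transitions $\mathbb P_h(s'\mid s,a,b)$, deterministic rewards $r_h(s,a,b)$, fixed initial state $s_1$, total reward in $[0,1]$ along every trajectory; the max-player uses $\upsilon_h:\mathcal S\to\Delta_{\mathcal A}$, the min-player $\mu_h:\mathcal S\to\Delta_{\mathcal B}$, $\pi=(\upsilon,\mu)$, $V_h^\pi$ is the value function of $\pi$ and $V^*,Q^*$ are the Nash values. Decoupled setting: only the max-player is controlled, the min-player is an adversary choosing $\mu^i$ arbitrarily in each episode. Write $Q(s,\upsilon,\mu)=\mathbb E_{a\sim\upsilon,b\sim\mu}Q(s,a,b)$. $f\in\mathcal F=\mathcal F_1\times\cdots\times\mathcal F_H$ gives $Q_{h,f}=f_h$ and a Nash pair $(\upsilon_f,\mu_f)$ of $Q_f$. Realizability: some $f^*\in\mathcal F$ has $Q_{h,f^*}=Q_h^*$ for all $h$. MG Bellman operator: $(\mathcal T_hf_{h+1})(s,a,b)=r_h(s,a,b)+\mathbb E_{s'\sim\mathbb P_h(\cdot\mid s,a,b)}[\max_\upsilon\min_\mu f_{h+1}(s',\upsilon,\mu)]$. Bellman residual: $\mathcal E_h(f,s,a,b)=(f_h-\mathcal T_hf_{h+1})(s,a,b)$, which equals $\mathbb E_{\zeta_h}[\ell_{h,f'}(\zeta_h,\eta_h,f,f)]$, where $\mathbb E_{\zeta_h}$ is expectation over $s_{h+1}\sim\mathbb P_h(\cdot\mid\eta_h)$. $R$ is an upper bound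 of $|\ell|$. **Minimax BE dimension.** $d_{\mathrm{ME}}(\mathcal F,\varepsilon)$ is the maximum over $h$ of the length $n$ of the longest sequence $(s_h^j,a_h^j,b_h^j)_{j\in[n]}$ such that for some $\varepsilon'\ge\varepsilon$ and each $j$ there is $f^j\in\mathcal F$ with $\sqrt{\sum_{i=1}^{j-1}\mathcal E_h(f^j,s_h^i,a_h^i,b_h^i)^2}\le\varepsilon'$ and $|\mathcal E_h(f^j,s_h^j,a_h^j,b_h^j)|>\varepsilon'$. **$\ell_2$-type EC class.** $(M,\mathcal F,\mathcal G,\ell,d,\kappa)$ ($\mathcal F\subset\mathcal G$ realizable, $\|\ell\|_2\le R$) is an $\ell_2$-type EC class if for every $\beta\ge R^2$ and $h\in[H]$: (i) for any $f^1,\dots,f^K\in\mathcal F$ and $\eta_h^1,\dots,\eta_h^K$, if $\sum_{i=1}^{k-1}\|\mathbb E_{\zeta_h}[\ell_{h,f^i}(\zeta_h,\eta_h^i,f^k,f^k)]\|_2^2\le\beta$ for all $k\in[K]$, then $\sum_{i=1}^k\|\mathbb E_{\zeta_h}[\ell_{h,f^i}(\zeta_h,\eta_h^i,f^i,f^i)]\|_2^2\le\mathcal O(d\beta\log k)$ for all $k\in[K]$ (here understood with $\log K$ on the right-hand side; $\mathcal O$ hides absolute constants and $R$); (ii) ($\kappa$-dominance) for any $k\in[K]$, with probability at least $1-\delta$, $\sum_{i=1}^k(V_{1,f^i}(s_1)-V_1^{\pi^i}(s_1))\le\kappa\sum_{h=1}^H\sum_{i=1}^k\mathbb E_{\eta_h\sim\pi^i}\|\mathbb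 E_{\zeta_h}[\ell_{h,f^i}(\zeta_h,\eta_h,f^i,f^i)]\|_2$ with $\pi^i=(\upsilon_{f^i},\mu^i)$. **Decomposable.** $\mathcal T(f^* )=f^*$ and $\ell_{h,f'}(\zeta_h,\eta_h,f,g)-\mathbb E_{\zeta_h}[\ell_{h,f'}(\zeta_h,\eta_h,f,g)]=\ell_{h,f'}(\zeta_h,\eta_h,f,\mathcal T(f))$.
   Formalization: Proved for K ≥ 2 and with d = max(1, d_ME(F, 1/√K)), since for K = 1 or d_ME = 0 the right-hand side is 0 while the left can be positive; the constant in O depends on R and is chosen for fixed underlying state and action types. *)

theory Defs
  imports "HOL-Probability.Probability"
begin

text \<open>
  The types \<open>'s\<close>, \<open>'a\<close>, \<open>'b\<close> are the state space and the two action spaces; the record carries a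
  sigma-algebra on each of them.  All three may be infinite.  Stages are numbered
  \<open>1, \<dots>, horizon M\<close>.
\<close>

record ('s, 'a, 'b) markov_game =
  states :: "'s measure"
  max_actions :: "'a measure"
  min_actions :: "'b measure"
  horizon :: nat
  trans :: "nat \<Rightarrow> 's \<times> 'a \<times> 'b \<Rightarrow> 's measure"
  reward :: "nat \<Rightarrow> 's \<times> 'a \<times> 'b \<Rightarrow> real"
  init :: 's

abbreviation turns :: "('s, 'a, 'b) markov_game \<Rightarrow> ('s \<times> 'a \<times> 'b) measure" where
  "turns M \<equiv> states M \<Otimes>\<^sub>M max_actions M \<Otimes>\<^sub>M min_actions M"

definition markov_game :: "('s, 'a, 'b) markov_game \<Rightarrow> bool" where
  "markov_game M \<longleftrightarrow>
     space (states M) = UNIV \<and> space (max_actions M) = UNIV \<and> space (min_actions M) = UNIV \<and>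
     1 \<le> horizon M \<and>
     (\<forall>h\<in>{1..horizon M}. trans M h \<in> turns M \<rightarrow>\<^sub>M prob_algebra (states M)) \<and>
     (\<forall>h\<in>{1..horizon M}. reward M h \<in> borel_measurable (turns M)) \<and>
     (\<forall>s a b. s 1 = init M \<longrightarrow> (\<Sum>h=1..horizon M. reward M h (s h, a h, b h)) \<in> {0..1})"

type_synonym ('s, 'a) policy = "nat \<Rightarrow> 's \<Rightarrow> 'a measure"

definition max_policies :: "('s, 'a, 'b) markov_game \<Rightarrow> ('s, 'a) policy set" where
  "max_policies M = {\<upsilon>. \<forall>h\<in>{1..horizon M}. \<upsilon> h \<in> states M \<rightarrow>\<^sub>M prob_algebra (max_actions M)}"

definition min_policies :: "('s, 'a, 'b) markov_game \<Rightarrow> ('s, 'b) policy set" where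
  "min_policies M = {\<mu>. \<forall>h\<in>{1..horizon M}. \<mu> h \<in> states M \<rightarrow>\<^sub>M prob_algebra (min_actions M)}"


subsection \<open>Trajectories, value functions and Nash values\<close>

text \<open>The law of \<open>(s\<^sub>h, a\<^sub>h, b\<^sub>h)\<close> given \<open>s\<^sub>h = s\<close>; the players randomize independently.\<close>

definition turn_law ::
  "('s, 'a, 'b) markov_game \<Rightarrow> ('s, 'a) policy \<Rightarrow> ('s, 'b) policy \<Rightarrow> nat \<Rightarrow> 's \<Rightarrow> ('s \<times> 'a \<times> 'b) measure"
where
  "turn_law M \<upsilon> \<mu> h s = return (states M) s \<Otimes>\<^sub>M \<upsilon> h s \<Otimes>\<^sub>M \<mu> h s"

text \<open>
  \<open>state_law M \<upsilon> \<mu> h s n\<close> is the law of the state at stage \<open>h + n\<close>, and \<open>eta_law M \<upsilon> \<mu> h s n\<close> the law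
  of the state and the two actions at stage \<open>h + n\<close>, when play starts in state \<open>s\<close> at stage \<open>h\<close>.
\<close>

primrec state_law ::
  "('s, 'a, 'b) markov_game \<Rightarrow> ('s, 'a) policy \<Rightarrow> ('s, 'b) policy \<Rightarrow> nat \<Rightarrow> 's \<Rightarrow> nat \<Rightarrow> 's measure"
where
  "state_law M \<upsilon> \<mu> h s 0 = return (states M) s"
| "state_law M \<upsilon> \<mu> h s (Suc n) =
     (state_law M \<upsilon> \<mu> h s n \<bind> turn_law M \<upsilon> \<mu> (h + n)) \<bind> trans M (h + n)"

definition eta_law ::
  "('s, 'a, 'b) markov_game \<Rightarrow> ('s, 'a) policy \<Rightarrow> ('s, 'b) policy \<Rightarrow> nat \<Rightarrow> 's \<Rightarrow> nat
     \<Rightarrow> ('s \<times> 'a \<times> 'b) measure"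
where
  "eta_law M \<upsilon> \<mu> h s n = state_law M \<upsilon> \<mu> h s n \<bind> turn_law M \<upsilon> \<mu> (h + n)"

text \<open>
  The expected reward collected from stage \<open>h\<close> to the horizon; at stage \<open>horizon M + 1\<close> the sum is
  empty and the value is \<open>0\<close>.
\<close>

definition V_pol ::
  "('s, 'a, 'b) markov_game \<Rightarrow> ('s, 'a) policy \<Rightarrow> ('s, 'b) policy \<Rightarrow> nat \<Rightarrow> 's \<Rightarrow> real"
where
  "V_pol M \<upsilon> \<mu> h s =
     (\<Sum>n<Suc (horizon M) - h. \<integral>\<eta>. reward M (h + n) \<eta> \<partial>eta_law M \<upsilon> \<mu> h s n)"

definition Q_pol ::
  "('s, 'a, 'b) markov_game \<Rightarrow> ('s, 'a) policy \<Rightarrow> ('s, 'b) policy \<Rightarrow> nat \<Rightarrow> 's \<times> 'a \<times> 'b \<Rightarrow> real"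
where
  "Q_pol M \<upsilon> \<mu> h \<eta> = reward M h \<eta> + (\<integral>s'. V_pol M \<upsilon> \<mu> (Suc h) s' \<partial>trans M h \<eta>)"

definition nash_equilibrium ::
  "('s, 'a, 'b) markov_game \<Rightarrow> ('s, 'a) policy \<Rightarrow> ('s, 'b) policy \<Rightarrow> bool"
where
  "nash_equilibrium M \<upsilon> \<mu> \<longleftrightarrow>
     \<upsilon> \<in> max_policies M \<and> \<mu> \<in> min_policies M \<and>
     (\<forall>h\<in>{1..horizon M}. \<forall>s.
        (\<forall>\<upsilon>'\<in>max_policies M. V_pol M \<upsilon>' \<mu> h s \<le> V_pol M \<upsilon> \<mu> h s) \<and>
        (\<forall>\<mu>'\<in>min_policies M. V_pol M \<upsilon> \<mu> h s \<le> V_pol M \<upsilon> \<mu>' h s))"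

text \<open>
  The game being zero-sum, all Nash equilibria have the same value, so \<open>q\<close> is determined at the
  stages \<open>1, \<dots>, horizon M\<close>.
\<close>

definition is_nash_Q ::
  "('s, 'a, 'b) markov_game \<Rightarrow> (nat \<Rightarrow> 's \<times> 'a \<times> 'b \<Rightarrow> real) \<Rightarrow> bool"
where
  "is_nash_Q M q \<longleftrightarrow>
     (\<exists>\<upsilon> \<mu>. nash_equilibrium M \<upsilon> \<mu> \<and> (\<forall>h\<in>{1..horizon M}. q h = Q_pol M \<upsilon> \<mu> h))"


subsection \<open>Action-value functions\<close>

text \<open>
  An action-value function assigns a function of state and actions to every stage and is \<open>0\<close> off the
  stages \<open>1, \<dots>, horizon M\<close>.  This implements the convention \<open>Q\<^bsub>H+1,f\<^esub> = 0\<close>, hence \<open>V\<^bsub>H+1,f\<^esub> = 0\<close>.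
\<close>

type_synonym ('s, 'a, 'b) qfun = "nat \<Rightarrow> 's \<times> 'a \<times> 'b \<Rightarrow> real"

definition prod_class ::
  "('s, 'a, 'b) markov_game \<Rightarrow> (nat \<Rightarrow> ('s \<times> 'a \<times> 'b \<Rightarrow> real) set) \<Rightarrow> ('s, 'a, 'b) qfun set"
where
  "prod_class M Fs = PiE_dflt {1..horizon M} (\<lambda>_. 0) Fs"

definition payoff :: "('s \<times> 'a \<times> 'b \<Rightarrow> real) \<Rightarrow> 's \<Rightarrow> 'a measure \<Rightarrow> 'b measure \<Rightarrow> real" where
  "payoff q s u m = (\<integral>(a, b). q (s, a, b) \<partial>(u \<Otimes>\<^sub>M m))"

text \<open>The max-min value of a stage; it is attained whenever the stage game has a Nash pair.\<close>

definition game_value ::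
  "('s, 'a, 'b) markov_game \<Rightarrow> ('s \<times> 'a \<times> 'b \<Rightarrow> real) \<Rightarrow> 's \<Rightarrow> real"
where
  "game_value M q s =
     (SUP u\<in>space (prob_algebra (max_actions M)).
        INF m\<in>space (prob_algebra (min_actions M)). payoff q s u m)"

definition nash_pair_of ::
  "('s, 'a, 'b) markov_game \<Rightarrow> ('s, 'a, 'b) qfun \<Rightarrow> ('s, 'a) policy \<Rightarrow> ('s, 'b) policy \<Rightarrow> bool"
where
  "nash_pair_of M f \<upsilon> \<mu> \<longleftrightarrow>
     \<upsilon> \<in> max_policies M \<and> \<mu> \<in> min_policies M \<and>
     (\<forall>h\<in>{1..horizon M}. \<forall>s.
        (\<forall>u\<in>space (prob_algebra (max_actions M)).
           payoff (f h) s u (\<mu> h s) \<le> payoff (f h) s (\<upsilon> h s) (\<mu> h s)) \<and>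
        (\<forall>m\<in>space (prob_algebra (min_actions M)).
           payoff (f h) s (\<upsilon> h s) (\<mu> h s) \<le> payoff (f h) s (\<upsilon> h s) m))"

definition action_value_class :: "('s, 'a, 'b) markov_game \<Rightarrow> ('s, 'a, 'b) qfun set \<Rightarrow> bool" where
  "action_value_class M F \<longleftrightarrow>
     (\<forall>f\<in>F. \<forall>h\<in>{1..horizon M}. f h \<in> borel_measurable (turns M) \<and> bounded (range (f h)))"

definition realizable :: "('s, 'a, 'b) markov_game \<Rightarrow> ('s, 'a, 'b) qfun set \<Rightarrow> bool" where
  "realizable M F \<longleftrightarrow> (\<exists>f\<in>F. is_nash_Q M f)"

definition bellman ::
  "('s, 'a, 'b) markov_game \<Rightarrow> nat \<Rightarrow> ('s \<times> 'a \<times> 'b \<Rightarrow> real) \<Rightarrow> 's \<times> 'a \<times> 'b \<Rightarrow> real"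
where
  "bellman M h q \<eta> = reward M h \<eta> + (\<integral>s'. game_value M q s' \<partial>trans M h \<eta>)"

definition bellman_op :: "('s, 'a, 'b) markov_game \<Rightarrow> ('s, 'a, 'b) qfun \<Rightarrow> ('s, 'a, 'b) qfun" where
  "bellman_op M f h = (if h \<in> {1..horizon M} then bellman M h (f (Suc h)) else (\<lambda>_. 0))"

definition residual ::
  "('s, 'a, 'b) markov_game \<Rightarrow> nat \<Rightarrow> ('s, 'a, 'b) qfun \<Rightarrow> 's \<times> 'a \<times> 'b \<Rightarrow> real"
where
  "residual M h f \<eta> = f h \<eta> - bellman M h (f (Suc h)) \<eta>"

text \<open>The value is \<open>\<infinity>\<close> if there are arbitrarily long such sequences.\<close>

definition minimax_BE_dim ::
  "('s, 'a, 'b) markov_game \<Rightarrow> ('s, 'a, 'b) qfun set \<Rightarrow> real \<Rightarrow> enat"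
where
  "minimax_BE_dim M F \<epsilon> =
     (SUP h\<in>{1..horizon M}. Sup {enat n | n. \<exists>(\<eta> :: nat \<Rightarrow> 's \<times> 'a \<times> 'b). \<exists>\<epsilon>'\<ge>\<epsilon>. \<forall>j\<in>{1..n}. \<exists>f\<in>F.
        sqrt (\<Sum>i=1..<j. (residual M h f (\<eta> i))\<^sup>2) \<le> \<epsilon>' \<and> \<bar>residual M h f (\<eta> j)\<bar> > \<epsilon>'})"


subsection \<open>EC classes\<close>

text \<open>
  Estimation functions \<open>\<ell>\<^bsub>h,f'\<^esub>(\<zeta>, \<eta>, f, g)\<close> with \<open>\<zeta> = s\<^bsub>h+1\<^esub>\<close> and \<open>\<eta> = (s\<^sub>h, a\<^sub>h, b\<^sub>h)\<close>, written
  \<open>ell h f' \<zeta> \<eta> f g\<close>, with values in a Euclidean space.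
\<close>

type_synonym ('s, 'a, 'b, 'v) estimation =
  "nat \<Rightarrow> ('s, 'a, 'b) qfun \<Rightarrow> 's \<Rightarrow> 's \<times> 'a \<times> 'b \<Rightarrow> ('s, 'a, 'b) qfun \<Rightarrow> ('s, 'a, 'b) qfun \<Rightarrow> 'v"

definition mean_est ::
  "('s, 'a, 'b) markov_game \<Rightarrow> ('s, 'a, 'b, 'v::euclidean_space) estimation \<Rightarrow> nat \<Rightarrow>
     ('s, 'a, 'b) qfun \<Rightarrow> 's \<times> 'a \<times> 'b \<Rightarrow> ('s, 'a, 'b) qfun \<Rightarrow> ('s, 'a, 'b) qfun \<Rightarrow> 'v"
where
  "mean_est M ell h f' \<eta> f g = (\<integral>\<zeta>. ell h f' \<zeta> \<eta> f g \<partial>trans M h \<eta>)"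

definition est_bound ::
  "('s, 'a, 'b) markov_game \<Rightarrow> ('s, 'a, 'b) qfun set \<Rightarrow> ('s, 'a, 'b) qfun set \<Rightarrow>
     ('s, 'a, 'b, 'v::euclidean_space) estimation \<Rightarrow> real \<Rightarrow> bool"
where
  "est_bound M F G ell R \<longleftrightarrow>
     (\<forall>h\<in>{1..horizon M}. \<forall>f'\<in>F. \<forall>f\<in>F. \<forall>g\<in>G. \<forall>\<zeta> \<eta>. norm (ell h f' \<zeta> \<eta> f g) \<le> R)"

text \<open>
  The number \<open>C\<close> is the constant hidden in the Landau symbol.  The inequality is stated in the
  extended reals because \<open>d\<close> may be infinite.  The right-hand side vanishes for \<open>d = 0\<close> and for
  \<open>K = 1\<close>.  With \<open>d\<close> the minimax BE dimension at scale \<open>1 / sqrt K\<close> the condition can fail in both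
  cases (for \<open>d = 0\<close> residuals up to \<open>1 / sqrt K\<close> are still possible), so it has to be read with
  \<open>max 1 d\<close> and \<open>K \<ge> 2\<close>.
\<close>

definition ec_condition ::
  "real \<Rightarrow> ('s, 'a, 'b) markov_game \<Rightarrow> ('s, 'a, 'b) qfun set \<Rightarrow>
     ('s, 'a, 'b, 'v::euclidean_space) estimation \<Rightarrow> real \<Rightarrow> enat \<Rightarrow> nat \<Rightarrow> bool"
where
  "ec_condition C M F ell R d K \<longleftrightarrow>
     (\<forall>\<beta>\<ge>R\<^sup>2. \<forall>h\<in>{1..horizon M}. \<forall>fs \<eta>.
        (\<forall>i\<in>{1..K}. fs i \<in> F) \<longrightarrow>
        (\<forall>k\<in>{1..K}. (\<Sum>i=1..<k. (norm (mean_est M ell h (fs i) (\<eta> i) (fs k) (fs k)))\<^sup>2) \<le> \<beta>) \<longrightarrow>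
        (\<forall>k\<in>{1..K}. ereal (\<Sum>i=1..k. (norm (mean_est M ell h (fs i) (\<eta> i) (fs i) (fs i)))\<^sup>2)
             \<le> ereal C * ereal_of_enat d * ereal \<beta> * ereal (ln (real K))))"

text \<open>
  The space \<open>\<Omega>\<close> carries the randomness of the interaction: the functions \<open>fs i\<close> chosen by the learner
  and the policies \<open>\<mu>s i\<close> chosen by the adversary in episode \<open>i\<close> are arbitrary functions of the
  outcome.  The learner plays \<open>\<upsilon>F f\<close>, the max-player's part of the Nash pair attached to \<open>f\<close>.
  The stage \<open>h\<close> is reached from stage \<open>1\<close> in \<open>h - 1\<close> steps.
\<close>

definition dominance ::
  "'w measure \<Rightarrow> ('s, 'a, 'b) markov_game \<Rightarrow> (('s, 'a, 'b) qfun \<Rightarrow> ('s, 'a) policy) \<Rightarrow>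
     ('s, 'a, 'b) qfun set \<Rightarrow> ('s, 'a, 'b, 'v::euclidean_space) estimation \<Rightarrow> real \<Rightarrow> nat \<Rightarrow> bool"
where
  "dominance \<Omega> M \<upsilon>F F ell \<kappa> K \<longleftrightarrow>
     (\<forall>fs \<mu>s. (\<forall>i\<in>{1..K}. \<forall>\<omega>\<in>space \<Omega>. fs i \<omega> \<in> F \<and> \<mu>s i \<omega> \<in> min_policies M) \<longrightarrow>
        (\<forall>\<delta>\<in>{0<..<1}. \<forall>k\<in>{1..K}. \<exists>A\<in>sets \<Omega>. measure \<Omega> A \<ge> 1 - \<delta> \<and>
           (\<forall>\<omega>\<in>A.
              (\<Sum>i=1..k. game_value M (fs i \<omega> 1) (init M)
                          - V_pol M (\<upsilon>F (fs i \<omega>)) (\<mu>s i \<omega>) 1 (init M))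
              \<le> \<kappa> * (\<Sum>h=1..horizon M. \<Sum>i=1..k.
                   \<integral>\<eta>. norm (mean_est M ell h (fs i \<omega>) \<eta> (fs i \<omega>) (fs i \<omega>))
                     \<partial>eta_law M (\<upsilon>F (fs i \<omega>)) (\<mu>s i \<omega>) 1 (init M) (h - 1)))))"

definition l2_EC_class ::
  "real \<Rightarrow> 'w measure \<Rightarrow> ('s, 'a, 'b) markov_game \<Rightarrow> (('s, 'a, 'b) qfun \<Rightarrow> ('s, 'a) policy) \<Rightarrow>
     ('s, 'a, 'b) qfun set \<Rightarrow> ('s, 'a, 'b) qfun set \<Rightarrow>
     ('s, 'a, 'b, 'v::euclidean_space) estimation \<Rightarrow> real \<Rightarrow> enat \<Rightarrow> real \<Rightarrow> nat \<Rightarrow> bool"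
where
  "l2_EC_class C \<Omega> M \<upsilon>F F G ell R d \<kappa> K \<longleftrightarrow>
     F \<subseteq> G \<and> realizable M F \<and> est_bound M F G ell R \<and>
     ec_condition C M F ell R d K \<and> dominance \<Omega> M \<upsilon>F F ell \<kappa> K"

definition decomposable ::
  "('s, 'a, 'b) markov_game \<Rightarrow> ('s, 'a, 'b) qfun set \<Rightarrow> ('s, 'a, 'b) qfun set \<Rightarrow>
     ('s, 'a, 'b, 'v::euclidean_space) estimation \<Rightarrow>
     (('s, 'a, 'b) qfun \<Rightarrow> ('s, 'a, 'b) qfun) \<Rightarrow> bool"
where
  "decomposable M F G ell T \<longleftrightarrow>
     T \<in> F \<rightarrow> G \<and>
     (\<forall>f\<in>F. is_nash_Q M f \<longrightarrow> T f = f) \<and>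
     (\<forall>h\<in>{1..horizon M}. \<forall>f'\<in>F. \<forall>f\<in>F. \<forall>g\<in>G. \<forall>\<zeta> \<eta>.
        ell h f' \<zeta> \<eta> f g - mean_est M ell h f' \<eta> f g = ell h f' \<zeta> \<eta> f (T f))"

definition mg_loss :: "('s, 'a, 'b) markov_game \<Rightarrow> ('s, 'a, 'b, real) estimation" where
  "mg_loss M h f' \<zeta> \<eta> f g = g h \<eta> - reward M h \<eta> - game_value M (f (Suc h)) \<zeta>"

end

(*
  Fix a level t.  The indices whose squared diagonal residual exceeds t can be distributed greedily
  over about beta / t buckets such that inside each bucket every residual function has squared sum
  at most t over the earlier points.  A bucket is then a sequence as in the definition of the
  minimax Bellman eluder dimension at scale sqrt t, so there are at most 2 d beta / t such
  indices as long as t is at least 1 / K.  Summing over the levels gives the factor ln K.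

  Dominance holds surely: max-min values of f telescope along the trajectory, each step losing the
  residual, since replacing the minimizing policy of the stage game by the policy of the adversary
  can only increase the payoff.
*)
theory Submission
  imports Defs
begin

text \<open>The combinatorial core concerns a nonnegative array \<open>w j i\<close>, later the
  squared residual of function \<open>j\<close> at point \<open>i\<close>: every row has mass at
  most \<beta> left of the diagonal, and the diagonal is to be summed. The dimension cannot be
  applied to all large diagonal entries at once, since it demands row sums below the very level that
  the entries exceed, while the hypothesis only grants \<beta>. Buckets split the mass of each row;
  rounding their number \<beta> / t up to an integer, with t < \<beta>, costs the factor 2. The
  dimension admits one common threshold per sequence, at least \<open>1 / sqrt K\<close>, hence a
  fixed level \<open>t\<close> of at least \<open>1 / K\<close>. The logarithm is harmonic: the
  \<open>n\<close>-th largest diagonal entry is at most the larger of \<open>1 / K\<close> and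
  \<open>2 \<beta> d / n\<close>. The floors \<open>1 / K\<close> add up to at most 1, and absorbing
  this 1 through R^2 \<le> \<beta> makes the constant depend on \<open>R\<close>. On the game side
  the obstacle is measurability: a max-min over uncountably many mixed actions need not be
  measurable in the state, so values are rewritten through the measurable Nash pair before they are
  integrated.\<close>

section \<open>Eluder-type summation\<close>

text \<open>
  Greedy assignment to \<open>m\<close> buckets: if every bucket contributed more than \<open>t\<close> to the sum of the
  current index, the whole prefix sum would exceed \<open>m * t \<ge> \<beta>\<close>.
\<close>

lemma bucket_assignment:
  fixes w :: "nat \<Rightarrow> nat \<Rightarrow> real" and m :: nat
  assumes nonneg: "\<And>j i. 0 \<le> w j i"
    and prefix_sums: "\<And>j. j \<in> S \<Longrightarrow> (\<Sum>i\<in>{i\<in>S. i < j}. w j i) \<le> \<beta>"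
    and m: "0 < m" "\<beta> \<le> real m * t"
  shows "\<exists>c. \<forall>j\<in>S. c j < m \<and> (\<Sum>i\<in>{i\<in>S. i < j \<and> c i = c j}. w j i) \<le> t"
proof -
  have free: "\<exists>l<m. (\<Sum>i\<in>{i\<in>S. i < j \<and> c i = l}. w j i) \<le> t"
    if "j \<in> S" "\<And>i. i \<in> S \<Longrightarrow> i < j \<Longrightarrow> c i < m" for j and c :: "nat \<Rightarrow> nat"
  proof (rule ccontr)
    assume "\<not> ?thesis"
    then have "(\<Sum>l<m. t) < (\<Sum>l<m. \<Sum>i\<in>{i\<in>S. i < j \<and> c i = l}. w j i)"
      using m(1) by (intro sum_strict_mono) (auto simp: not_le)
    also have "\<dots> = (\<Sum>l<m. \<Sum>i\<in>{x\<in>{i\<in>S. i < j}. c x = l}. w j i)"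
      by (intro sum.cong) auto
    also have "\<dots> = (\<Sum>i\<in>{i\<in>S. i < j}. w j i)"
      using that(2) by (intro sum.group) auto
    also have "\<dots> \<le> \<beta>"
      by (rule prefix_sums[OF that(1)])
    finally show False
      using m(2) by simp
  qed
  define P where "P N c \<longleftrightarrow> (\<forall>j\<in>S. j < N \<longrightarrow>
      c j < m \<and> (\<Sum>i\<in>{i\<in>S. i < j \<and> c i = c j}. w j i) \<le> t)" for N and c :: "nat \<Rightarrow> nat"
  \<comment> \<open>Stage \<open>N\<close> of the recursion is a whole assignment of which only the
    entries below \<open>N\<close> are settled. The next stage overwrites entry \<open>N\<close>
    with a bucket that \<open>free\<close> provides; for \<open>N\<close> outside \<open>S\<close>
    the choice is arbitrary and \<open>P\<close> claims nothing.\<close>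
  define c where "c = rec_nat (\<lambda>_. 0)
      (\<lambda>N c. c(N := SOME l. l < m \<and> (\<Sum>i\<in>{i\<in>S. i < N \<and> c i = l}. w N i) \<le> t))"
  have c_Suc: "c (Suc N) = (c N)(N := SOME l. l < m \<and>
      (\<Sum>i\<in>{i\<in>S. i < N \<and> c N i = l}. w N i) \<le> t)" for N
    by (simp add: c_def)
  have P: "P N (c N)" for N
  proof (induction N)
    case (Suc N)
    have agree: "{i\<in>S. i < j \<and> c (Suc N) i = l} = {i\<in>S. i < j \<and> c N i = l}" if "j \<le> N" for j l
      using that by (auto simp: c_Suc)
    show ?case
      unfolding P_def
    proof (intro ballI impI)
      fix j assume j: "j \<in> S" "j < Suc N"
      show "c (Suc N) j < m \<and> (\<Sum>i\<in>{i\<in>S. i < j \<and> c (Suc N) i = c (Suc N) j}. w j i) \<le> t"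
      proof (cases "j = N")
        case True
        have "\<exists>l. l < m \<and> (\<Sum>i\<in>{i\<in>S. i < N \<and> c N i = l}. w N i) \<le> t"
          using free[of N "c N"] Suc j True by (auto simp: P_def)
        from someI_ex[OF this] show ?thesis
          using True agree[of N] by (simp add: c_Suc)
      next
        case False
        then show ?thesis
          using Suc j agree[of j] by (simp add: P_def c_Suc)
      qed
    qed
  qed (simp add: P_def)
  have stable: "c (N + n) j = c N j" if "j < N" for N n j
    using that by (induction n) (auto simp: c_Suc)
  have eq: "c N j = c (Suc j) j" if "j < N" for N j
    using stable[of j "Suc j" "N - Suc j"] that by simp
  \<comment> \<open>Entry \<open>j\<close> is final from stage \<open>Suc j\<close> on, so reading
    each entry there gives the limit of all stages.\<close>
  define b where "b j = c (Suc j) j" for j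
  have b: "c (Suc j) i = b i" if "i \<le> j" for i j
    unfolding b_def by (rule eq) (use that in simp)
  have "b j < m \<and> (\<Sum>i\<in>{i\<in>S. i < j \<and> b i = b j}. w j i) \<le> t" if j: "j \<in> S" for j
  proof -
    have "{i\<in>S. i < j \<and> c (Suc j) i = c (Suc j) j} = {i\<in>S. i < j \<and> b i = b j}"
      using b[of _ j] by auto
    moreover have "c (Suc j) j < m \<and> (\<Sum>i\<in>{i\<in>S. i < j \<and> c (Suc j) i = c (Suc j) j}. w j i) \<le> t"
      using P[of "Suc j"] j unfolding P_def by blast
    ultimately show ?thesis
      using b[of j j] by simp
  qed
  then show ?thesis
    by blast
qed

text \<open>
  Remove a smallest element: its value is at most \<open>max t0 (D / card A)\<close>, because all of \<open>A\<close> lies above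
  any smaller level.
\<close>

lemma sum_le_of_superlevel_card:
  fixes a :: "'i \<Rightarrow> real"
  assumes "finite A" "0 < t0" "0 \<le> D"
    and level: "\<And>t. t0 \<le> t \<Longrightarrow> real (card {i\<in>A. t < a i}) * t \<le> D"
  shows "sum a A \<le> real (card A) * t0 + D * harm (card A)"
  using assms(1) level
proof (induction "card A" arbitrary: A)
  case (Suc n)
  have "A \<noteq> {}" using Suc by auto
  obtain i0 where i0: "i0 \<in> A" "\<And>i. i \<in> A \<Longrightarrow> a i0 \<le> a i"
    using arg_min_least[OF Suc.prems(1) \<open>A \<noteq> {}\<close>, where f = a]
      arg_min_if_finite(1)[OF Suc.prems(1) \<open>A \<noteq> {}\<close>, where f = a] by blast
  have card: "card (A - {i0}) = n"
    using Suc i0 by simp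
  have rest: "sum a (A - {i0}) \<le> real n * t0 + D * harm n"
  proof -
    have "real (card {i \<in> A - {i0}. t < a i}) * t \<le> D" if "t0 \<le> t" for t
    proof -
      have "card {i \<in> A - {i0}. t < a i} \<le> card {i \<in> A. t < a i}"
        using Suc.prems(1) by (intro card_mono) auto
      then have "real (card {i \<in> A - {i0}. t < a i}) * t \<le> real (card {i \<in> A. t < a i}) * t"
        using that assms(2) by (intro mult_right_mono) auto
      then show ?thesis using Suc.prems(2)[OF that] by simp
    qed
    then show ?thesis
      using Suc.hyps(1)[of "A - {i0}"] Suc.prems(1) card by simp
  qed
  have "a i0 \<le> max t0 (D / real (Suc n))"
  proof (rule ccontr)
    assume "\<not> ?thesis"
    then obtain t where t: "max t0 (D / real (Suc n)) < t" "t < a i0"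
      using dense[of "max t0 (D / real (Suc n))" "a i0"] unfolding not_le by blast
    then have "{i\<in>A. t < a i} = A" using i0 by force
    then have "real (Suc n) * t \<le> D"
      using Suc.prems(2)[of t] t Suc.hyps(2) by simp
    then show False using t by (simp add: field_simps)
  qed
  also have "\<dots> \<le> t0 + D / real (Suc n)"
    using assms by simp
  finally have "a i0 \<le> t0 + D / real (Suc n)" .
  moreover have "sum a A = a i0 + sum a (A - {i0})"
    using i0 Suc.prems(1) by (simp add: sum.remove)
  ultimately have "sum a A \<le> real (Suc n) * t0 + D * harm (Suc n)"
    using rest by (simp add: harm_Suc algebra_simps divide_inverse)
  then show ?case using Suc.hyps(2) by simp
qed (simp add: harm_def)

text \<open>The sequence \<open>harm n - ln n\<close> decreases and starts at
  \<open>1\<close>.\<close>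

lemma harm_le_ln_plus_one:
  assumes "1 \<le> n"
  shows "(harm n :: real) \<le> ln (real n) + 1"
  using euler_mascheroni_sequence_decreasing[of 1 n]
  using assms by (simp add: harm_def)

text \<open>\<open>independent\<close> is the dimension bound stripped of games. It is applied to
  every fibre of the bucket map, and the count is at most the number of buckets times
  \<open>D\<close>.\<close>

lemma superlevel_card_le:
  fixes w :: "nat \<Rightarrow> nat \<Rightarrow> real"
  assumes nonneg: "\<And>j i. 0 \<le> w j i"
    and prefix_sums: "\<And>j. j \<in> {1..K} \<Longrightarrow> (\<Sum>i=1..<j. w j i) \<le> \<beta>"
    and diag: "\<And>i. i \<in> {1..K} \<Longrightarrow> w i i \<le> \<beta>"
    and independent: "\<And>B. B \<subseteq> {1..K} \<Longrightarrow>
      (\<And>j. j \<in> B \<Longrightarrow> (\<Sum>i\<in>{i\<in>B. i < j}. w j i) \<le> t \<and> t < w j j) \<Longrightarrow> card B \<le> D"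
    and "0 < t" "A \<subseteq> {1..K}" "0 \<le> \<beta>"
  shows "real (card {i\<in>A. t < w i i}) * t \<le> 2 * \<beta> * real D"
proof (cases "t < \<beta>")
  case False
  then have empty: "{i\<in>A. t < w i i} = {}"
    using diag assms(6) by force
  show ?thesis
    unfolding empty using assms(7) by simp
next
  case True
  define S where "S = {i\<in>A. t < w i i}"
  \<comment> \<open>The least number of buckets for which \<open>bucket_assignment\<close> applies,
    namely with \<open>\<beta> \<le> m * t\<close>.\<close>
  define m where "m = nat \<lceil>\<beta> / t\<rceil>"
  have S: "S \<subseteq> {1..K}" "finite S"
    using assms(6) finite_subset[of A "{1..K}"] by (auto simp: S_def)
  have pos: "0 < \<beta> / t" using True assms(5) by simp
  have "\<beta> / t \<le> real m"
    using pos by (simp add: m_def)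
  then have m: "0 < m" "\<beta> \<le> real m * t"
    using pos assms(5) by (simp add: m_def, simp add: pos_divide_le_eq)
  have "(\<Sum>i\<in>{i\<in>S. i < j}. w j i) \<le> \<beta>" if "j \<in> S" for j
  proof -
    have "(\<Sum>i\<in>{i\<in>S. i < j}. w j i) \<le> (\<Sum>i=1..<j. w j i)"
      using S nonneg by (intro sum_mono2) auto
    also have "\<dots> \<le> \<beta>" using prefix_sums that S by auto
    finally show ?thesis .
  qed
  from bucket_assignment[of w S, OF nonneg this m]
  obtain c where c: "\<And>j. j \<in> S \<Longrightarrow> c j < m"
    "\<And>j. j \<in> S \<Longrightarrow> (\<Sum>i\<in>{i\<in>S. i < j \<and> c i = c j}. w j i) \<le> t"
    by blast
  have "card S = (\<Sum>l<m. card {j\<in>S. c j = l})"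
    using sum.group[of S "{..<m}" c "\<lambda>_. 1 :: nat"] S c(1) by (simp add: image_subset_iff)
  also have "\<dots> \<le> (\<Sum>l<m. D)"
  proof (rule sum_mono)
    fix l
    show "card {j\<in>S. c j = l} \<le> D"
    proof (rule independent)
      fix j assume j: "j \<in> {j\<in>S. c j = l}"
      have "{i \<in> {j\<in>S. c j = l}. i < j} = {i\<in>S. i < j \<and> c i = c j}"
        using j by auto
      then show "(\<Sum>i | i \<in> {j\<in>S. c j = l} \<and> i < j. w j i) \<le> t \<and> t < w j j"
        using c(2)[of j] j by (simp add: S_def)
    qed (use S in auto)
  qed
  finally have "card S \<le> m * D" by simp
  then have "real (card S) \<le> real m * real D"
    by (simp flip: of_nat_mult)
  also have "real m \<le> 2 * \<beta> / t"
  proof -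
    have "real m \<le> \<beta> / t + 1" using pos by (simp add: m_def)
    also have "1 \<le> \<beta> / t" using True assms(5) by simp
    finally show ?thesis by simp
  qed
  finally have "real (card S) \<le> 2 * \<beta> / t * real D"
    by (simp add: mult_right_mono)
  then show ?thesis
    using assms(5) by (simp add: field_simps S_def)
qed

text \<open>
  For \<open>R > 0\<close> the summands absorb \<open>1\<close> (as \<open>1 \<le> \<beta> / R\<^sup>2\<close>) and \<open>2 * \<beta> * D * (ln K + 1)\<close>, using
  \<open>ln 2 \<le> ln K\<close>.  For \<open>R = 0\<close> all residuals vanish, and the junk value \<open>1 / 0 = 0\<close> is harmless.
\<close>

definition ec_const :: "real \<Rightarrow> real" where
  "ec_const R = 1 / (R\<^sup>2 * ln 2) + 2 * (1 / ln 2 + 1)"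

lemma ec_const_pos: "0 < ec_const R"
  by (simp add: ec_const_def add_nonneg_pos)

text \<open>The floor of the level argument is \<open>1 / K\<close>, from which on
  \<open>independent\<close> is available. At most \<open>K\<close> indices are charged this floor,
  which gives the summand \<open>1\<close> in the intermediate bound.\<close>

lemma eluder_sum_le:
  fixes w :: "nat \<Rightarrow> nat \<Rightarrow> real"
  assumes nonneg: "\<And>j i. 0 \<le> w j i"
    and prefix_sums: "\<And>j. j \<in> {1..K} \<Longrightarrow> (\<Sum>i=1..<j. w j i) \<le> \<beta>"
    and diag: "\<And>i. i \<in> {1..K} \<Longrightarrow> w i i \<le> R\<^sup>2" "R\<^sup>2 \<le> \<beta>"
    and independent: "\<And>B t. B \<subseteq> {1..K} \<Longrightarrow> 1 / real K \<le> t \<Longrightarrow>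
      (\<And>j. j \<in> B \<Longrightarrow> (\<Sum>i\<in>{i\<in>B. i < j}. w j i) \<le> t \<and> t < w j j) \<Longrightarrow> card B \<le> D"
    and "1 \<le> D" "2 \<le> K" "k \<in> {1..K}"
  shows "(\<Sum>i=1..k. w i i) \<le> ec_const R * real D * \<beta> * ln (real K)"
proof (cases "R = 0")
  case True
  then have "(\<Sum>i=1..k. w i i) \<le> 0"
    using diag(1) assms(8) by (intro sum_nonpos) auto
  also have "0 \<le> ec_const R * real D * \<beta> * ln (real K)"
    using ec_const_pos[of R] assms True by (intro mult_nonneg_nonneg) auto
  finally show ?thesis .
next
  case False
  have R: "0 < R\<^sup>2" using False by simp
  have \<beta>: "0 < \<beta>" using R diag(2) by linarith
  have lnK: "ln 2 \<le> ln (real K)" "0 < ln (2 :: real)" using assms by auto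
  have "(\<Sum>i=1..k. w i i) \<le> real (card {1..k}) * (1 / real K) + 2 * \<beta> * real D * harm (card {1..k})"
  proof (rule sum_le_of_superlevel_card)
    fix t :: real assume t: "1 / real K \<le> t"
    have "0 < 1 / real K" using assms by simp
    then have "0 < t" using t by linarith
    then show "real (card {i \<in> {1..k}. t < w i i}) * t \<le> 2 * \<beta> * real D"
    proof (intro superlevel_card_le[where K = K and w = w])
      show "w i i \<le> \<beta>" if "i \<in> {1..K}" for i
        using diag(1)[OF that] diag(2) by linarith
      show "card B \<le> D"
        if "B \<subseteq> {1..K}"
          "\<And>j. j \<in> B \<Longrightarrow> (\<Sum>i\<in>{i\<in>B. i < j}. w j i) \<le> t \<and> t < w j j" for B
        using independent[OF that(1) t that(2)] .
    qed (use assms(8) \<beta> \<open>0 < t\<close> in \<open>auto intro: nonneg prefix_sums[simplified]\<close>)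
  qed (use assms \<beta> in auto)
  also have "\<dots> \<le> 1 + 2 * \<beta> * real D * (ln (real K) + 1)"
  proof (intro add_mono mult_left_mono)
    have "(harm k :: real) \<le> ln (real k) + 1"
      using assms by (intro harm_le_ln_plus_one) auto
    also have "\<dots> \<le> ln (real K) + 1" using assms by simp
    finally show "harm (card {1..k}) \<le> ln (real K) + 1" by simp
  qed (use assms \<beta> in \<open>auto simp: field_simps\<close>)
  also have "1 + 2 * \<beta> * real D * (ln (real K) + 1) \<le> ec_const R * real D * \<beta> * ln (real K)"
  proof -
    have D: "1 \<le> real D" using assms by simp
    have one: "1 \<le> ln (real K) / ln 2" using lnK by simp
    have "1 \<le> \<beta> / R\<^sup>2" using diag(2) R by simp
    moreover have "1 \<le> x * y" if "1 \<le> x" "1 \<le> y" for x y :: real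
      using mult_mono[OF that] that by simp
    ultimately have a: "1 \<le> \<beta> / R\<^sup>2 * (ln (real K) / ln 2) * real D"
      using one D by blast
    have "2 * \<beta> * real D * (ln (real K) + 1) \<le> 2 * \<beta> * real D * (ln (real K) + ln (real K) / ln 2)"
      using one \<beta> D by (intro mult_left_mono) auto
    with a have "1 + 2 * \<beta> * real D * (ln (real K) + 1) \<le> \<beta> / R\<^sup>2 * (ln (real K) / ln 2) * real D
        + 2 * \<beta> * real D * (ln (real K) + ln (real K) / ln 2)"
      by linarith
    also have "\<dots> = ec_const R * real D * \<beta> * ln (real K)"
      using R lnK by (simp add: ec_const_def field_simps)
    finally show ?thesis .
  qed
  finally show ?thesis .
qed

section \<open>From index sets to sequences of the Bellman eluder dimension\<close>

lemma sequence_of_finite_set: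
  fixes w :: "nat \<Rightarrow> nat \<Rightarrow> real"
  assumes "finite B" "\<And>j i. 0 \<le> w j i"
  obtains g where "\<And>j. j \<in> {1..card B} \<Longrightarrow> g j \<in> B"
    "\<And>j. j \<in> {1..card B} \<Longrightarrow> (\<Sum>i=1..<j. w (g j) (g i)) \<le> (\<Sum>i\<in>{i\<in>B. i < g j}. w (g j) i)"
proof -
  obtain r :: "nat \<Rightarrow> nat" where r: "strict_mono_on {..<card B} r" "\<And>n. n < card B \<Longrightarrow> r n \<in> B"
    using finite_enumerate[OF assms(1)] by blast
  \<comment> \<open>The enumeration \<open>r\<close> starts at \<open>0\<close>, the sequences of
    the dimension at \<open>1\<close>.\<close>
  define g where "g j = r (j - 1)" for j
  have mono: "g i < g j" if "1 \<le> i" "i < j" "j \<le> card B" for i j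
    unfolding g_def by (rule strict_mono_onD[OF r(1)]) (use that in auto)
  have mem: "g j \<in> B" if "j \<in> {1..card B}" for j
    using that by (auto simp: g_def intro!: r(2))
  show thesis
  proof
    fix j assume j: "j \<in> {1..card B}"
    have inj: "inj_on g {1..<j}"
      using j mono by (intro linorder_inj_onI') (force simp: less_imp_neq)
    have "(\<Sum>i=1..<j. w (g j) (g i)) = (\<Sum>i\<in>g ` {1..<j}. w (g j) i)"
      using sum.reindex[OF inj, of "w (g j)"] by (simp add: o_def)
    \<comment> \<open>Monotonicity puts the earlier values of \<open>g\<close> among the members of
      \<open>B\<close> below \<open>g j\<close>; nonnegativity lets the sum grow.\<close>
    also have "\<dots> \<le> (\<Sum>i\<in>{i\<in>B. i < g j}. w (g j) i)"
      using j mono mem assms by (intro sum_mono2) auto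
    finally show "(\<Sum>i=1..<j. w (g j) (g i)) \<le> (\<Sum>i\<in>{i\<in>B. i < g j}. w (g j) i)" .
  qed (rule mem)
qed

text \<open>Listed in increasing order, \<open>B\<close> is itself a witness sequence: position
  \<open>j\<close> carries the point and the function of index \<open>g j\<close>. The hypothesis
  compares squares because the summation works with squared residuals, while the dimension takes
  roots.\<close>

lemma card_le_minimax_BE_dim:
  fixes \<eta> :: "nat \<Rightarrow> _"
  assumes "minimax_BE_dim M F \<epsilon> \<le> enat D" "h \<in> {1..horizon M}" "finite B" "\<epsilon> \<le> \<epsilon>'" "0 \<le> \<epsilon>'"
    and fs: "\<And>j. j \<in> B \<Longrightarrow> fs j \<in> F"
    and indep: "\<And>j. j \<in> B \<Longrightarrow> (\<Sum>i\<in>{i\<in>B. i < j}. (residual M h (fs j) (\<eta> i))\<^sup>2) \<le> \<epsilon>'\<^sup>2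
      \<and> \<epsilon>'\<^sup>2 < (residual M h (fs j) (\<eta> j))\<^sup>2"
  shows "card B \<le> D"
proof -
  obtain g where g: "\<And>j. j \<in> {1..card B} \<Longrightarrow> g j \<in> B"
    "\<And>j. j \<in> {1..card B} \<Longrightarrow> (\<Sum>i=1..<j. (residual M h (fs (g j)) (\<eta> (g i)))\<^sup>2)
        \<le> (\<Sum>i\<in>{i\<in>B. i < g j}. (residual M h (fs (g j)) (\<eta> i))\<^sup>2)"
    using sequence_of_finite_set[OF assms(3), of "\<lambda>j i. (residual M h (fs j) (\<eta> i))\<^sup>2"] by auto
  have "\<exists>f\<in>F. sqrt (\<Sum>i=1..<j. (residual M h f ((\<eta> \<circ> g) i))\<^sup>2) \<le> \<epsilon>' \<and>
      \<epsilon>' < \<bar>residual M h f ((\<eta> \<circ> g) j)\<bar>" if j: "j \<in> {1..card B}" for j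
  proof (intro bexI[of _ "fs (g j)"] conjI)
    have "(\<Sum>i=1..<j. (residual M h (fs (g j)) ((\<eta> \<circ> g) i))\<^sup>2) \<le> \<epsilon>'\<^sup>2"
      using g[OF j] indep[of "g j"] by auto
    then show "sqrt (\<Sum>i=1..<j. (residual M h (fs (g j)) ((\<eta> \<circ> g) i))\<^sup>2) \<le> \<epsilon>'"
      using assms(5) by (simp add: real_le_lsqrt sum_nonneg real_sqrt_le_iff)
    have "\<bar>\<epsilon>'\<bar> < \<bar>residual M h (fs (g j)) (\<eta> (g j))\<bar>"
      using real_sqrt_less_mono[OF conjunct2[OF indep[OF g(1)[OF j]]]] by simp
    then show "\<epsilon>' < \<bar>residual M h (fs (g j)) ((\<eta> \<circ> g) j)\<bar>"
      using assms(5) by simp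
  qed (use fs g(1)[OF j] in auto)
  then have "enat (card B) \<in> {enat n | n. \<exists>(\<eta> :: nat \<Rightarrow> _). \<exists>\<epsilon>'\<ge>\<epsilon>. \<forall>j\<in>{1..n}. \<exists>f\<in>F.
        sqrt (\<Sum>i=1..<j. (residual M h f (\<eta> i))\<^sup>2) \<le> \<epsilon>' \<and> \<bar>residual M h f (\<eta> j)\<bar> > \<epsilon>'}"
    using assms(4) by (intro CollectI exI[of _ "card B"] conjI refl exI[of _ "\<eta> \<circ> g"] exI[of _ \<epsilon>']) auto
  then have "enat (card B) \<le> minimax_BE_dim M F \<epsilon>"
    unfolding minimax_BE_dim_def by (intro SUP_upper2[OF assms(2)] Sup_upper)
  from order_trans[OF this assms(1)] show ?thesis
    by simp
qed

lemma residual_sum_le: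
  assumes "h \<in> {1..horizon M}" "2 \<le> K" "R\<^sup>2 \<le> \<beta>"
    and fs: "\<And>i. i \<in> {1..K} \<Longrightarrow> fs i \<in> F"
    and bound: "\<And>f \<eta>. f \<in> F \<Longrightarrow> \<bar>residual M h f \<eta>\<bar> \<le> R"
    and prefix_sums: "\<And>k. k \<in> {1..K} \<Longrightarrow> (\<Sum>i=1..<k. (residual M h (fs k) (\<eta> i))\<^sup>2) \<le> \<beta>"
    and k: "k \<in> {1..K}"
    and d: "d = max 1 (minimax_BE_dim M F (1 / sqrt (real K)))"
  shows "ereal (\<Sum>i=1..k. (residual M h (fs i) (\<eta> i))\<^sup>2)
    \<le> ereal (ec_const R) * ereal_of_enat d * ereal \<beta> * ereal (ln (real K))"
proof -
  have diag: "(residual M h (fs i) (\<eta> i))\<^sup>2 \<le> R\<^sup>2" if "i \<in> {1..K}" for i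
    using power_mono[OF bound[OF fs[OF that], of "\<eta> i"], of 2] by simp
  have \<beta>: "0 \<le> \<beta>" using assms(3) zero_le_power2[of R] by linarith
  show ?thesis
  proof (cases d)
    case (enat D)
    \<comment> \<open>The \<open>max 1\<close> in \<open>d\<close> provides
      \<open>1 \<le> D\<close>, by which the additive \<open>1\<close> of the summation is
      absorbed.\<close>
    have D: "minimax_BE_dim M F (1 / sqrt (real K)) \<le> enat D" "1 \<le> D"
      using max.cobounded2[of "minimax_BE_dim M F (1 / sqrt (real K))" "1 :: enat"]
        max.cobounded1[of "1 :: enat" "minimax_BE_dim M F (1 / sqrt (real K))"]
      unfolding d[symmetric] enat by (simp_all add: one_enat_def)
    have "(\<Sum>i=1..k. (residual M h (fs i) (\<eta> i))\<^sup>2) \<le> ec_const R * real D * \<beta> * ln (real K)"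
    proof (rule eluder_sum_le[where w = "\<lambda>j i. (residual M h (fs j) (\<eta> i))\<^sup>2"])
      fix B t
      assume B: "B \<subseteq> {1..K}" and t: "1 / real K \<le> t"
        and indep: "\<And>j. j \<in> B \<Longrightarrow> (\<Sum>i\<in>{i\<in>B. i < j}. (residual M h (fs j) (\<eta> i))\<^sup>2) \<le> t
           \<and> t < (residual M h (fs j) (\<eta> j))\<^sup>2"
      have "0 \<le> 1 / real K" by simp
      then have "0 \<le> t" using t by linarith
      \<comment> \<open>Levels are squared scales, so the witness sequence has threshold
        \<open>sqrt t\<close>.\<close>
      moreover have "1 / sqrt (real K) \<le> sqrt t"
        using t by (metis real_sqrt_divide real_sqrt_le_iff real_sqrt_one)
      ultimately show "card B \<le> D"
        using B indep finite_subset[OF B]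
        by (intro card_le_minimax_BE_dim[OF D(1) assms(1), where \<epsilon>' = "sqrt t" and fs = fs and \<eta> = \<eta>])
          (auto intro!: fs)
    qed (use assms(2,3) k D(2) diag prefix_sums in simp_all)
    then show ?thesis by (simp add: enat)
  next
    \<comment> \<open>The right-hand side is infinite unless \<beta> = 0, where
      \<open>\<infinity> * 0 = 0\<close> in the extended reals; then \<open>R = 0\<close> and all
      residuals vanish.\<close>
    case infinity
    show ?thesis
    proof (cases "\<beta> = 0")
      case True
      have "(\<Sum>i=1..k. (residual M h (fs i) (\<eta> i))\<^sup>2) \<le> 0"
      proof (rule sum_nonpos)
        fix i assume "i \<in> {1..k}"
        then have "(residual M h (fs i) (\<eta> i))\<^sup>2 \<le> R\<^sup>2"
          using k by (intro diag) auto
        with assms(3) True show "(residual M h (fs i) (\<eta> i))\<^sup>2 \<le> 0"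
          by linarith
      qed
      then show ?thesis using True by (simp flip: zero_ereal_def)
    next
      case False
      then show ?thesis
        using infinity ec_const_pos[of R] \<beta> assms(2) by simp
    qed
  qed
qed

section \<open>Bounded measurable functions and probability kernels\<close>

text \<open>Boundedness is asked at every point of the type, not almost everywhere, so that one
  condition gives integrability under all probability measures on \<open>N\<close> and survives
  integration against kernels.\<close>

definition bounded_measurable :: "'x measure \<Rightarrow> ('x \<Rightarrow> real) set" where
  "bounded_measurable N = {f \<in> borel_measurable N. bounded (range f)}"

lemma bounded_measurableI:
  assumes "f \<in> borel_measurable N" "\<And>x. \<bar>f x\<bar> \<le> B"
  shows "f \<in> bounded_measurable N"
  using assms by (auto simp: bounded_measurable_def bounded_iff)

lemma bounded_measurableE:
  assumes "f \<in> bounded_measurable N"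
  obtains B where "f \<in> borel_measurable N" "\<And>x. \<bar>f x\<bar> \<le> B"
  using assms by (auto simp: bounded_measurable_def bounded_iff)

lemma bounded_measurable_const: "(\<lambda>_. c) \<in> bounded_measurable N"
  by (rule bounded_measurableI[where B = "\<bar>c\<bar>"]) auto

lemma bounded_measurable_abs:
  "f \<in> bounded_measurable N \<Longrightarrow> (\<lambda>x. \<bar>f x\<bar>) \<in> bounded_measurable N"
  by (elim bounded_measurableE) (auto intro!: bounded_measurableI)

lemma bounded_measurable_add:
  assumes "f \<in> bounded_measurable N" "g \<in> bounded_measurable N"
  shows "(\<lambda>x. f x + g x) \<in> bounded_measurable N"
proof -
  from assms obtain A B where "f \<in> borel_measurable N" "g \<in> borel_measurable N"
      and *: "\<And>x. \<bar>f x\<bar> \<le> A" "\<And>x. \<bar>g x\<bar> \<le> B"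
    by (metis bounded_measurableE)
  moreover have "\<bar>f x + g x\<bar> \<le> A + B" for x
    using *[of x] by linarith
  ultimately show ?thesis
    by (intro bounded_measurableI[where B = "A + B"]) auto
qed

lemma bounded_measurable_diff:
  assumes "f \<in> bounded_measurable N" "g \<in> bounded_measurable N"
  shows "(\<lambda>x. f x - g x) \<in> bounded_measurable N"
proof -
  from assms obtain A B where "f \<in> borel_measurable N" "g \<in> borel_measurable N"
      and *: "\<And>x. \<bar>f x\<bar> \<le> A" "\<And>x. \<bar>g x\<bar> \<le> B"
    by (metis bounded_measurableE)
  moreover have "\<bar>f x - g x\<bar> \<le> A + B" for x
    using *[of x] by linarith
  ultimately show ?thesis
    by (intro bounded_measurableI[where B = "A + B"]) auto
qed

lemma bounded_measurable_sum:
  assumes "\<And>i. i \<in> I \<Longrightarrow> f i \<in> bounded_measurable N"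
  shows "(\<lambda>x. \<Sum>i\<in>I. f i x) \<in> bounded_measurable N"
  using assms
  by (induction I rule: infinite_finite_induct)
    (simp_all add: bounded_measurable_const bounded_measurable_add)

lemma measurable_prob_algebra_cong:
  "P \<in> space (prob_algebra N) \<Longrightarrow> measurable P L = measurable N L"
  by (intro measurable_cong_sets) (auto simp: space_prob_algebra)

lemma integrable_bounded_measurable:
  assumes "f \<in> bounded_measurable N" "P \<in> space (prob_algebra N)"
  shows "integrable P f"
proof -
  interpret prob_space P using assms by (simp add: space_prob_algebra)
  obtain B where "f \<in> borel_measurable N" "\<And>x. \<bar>f x\<bar> \<le> B"
    using assms(1) by (rule bounded_measurableE) blast
  then show ?thesis
    using measurable_prob_algebra_cong[OF assms(2), of borel]
    by (intro integrable_const_bound[where B = B]) auto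
qed

text \<open>A non-integrable function has integral \<open>0\<close> by convention, which also lies
  within the bound. This covers payoffs of functions about which only a bound is known.\<close>

lemma abs_integral_le_of_prob_algebra:
  assumes "P \<in> space (prob_algebra N)" "\<And>x. \<bar>f x\<bar> \<le> (B :: real)"
  shows "\<bar>integral\<^sup>L P f\<bar> \<le> B"
proof (cases "integrable P f")
  case True
  interpret prob_space P using assms by (simp add: space_prob_algebra)
  have "- B \<le> f x" "f x \<le> B" for x using assms(2)[of x] by linarith+
  then show ?thesis
    using integral_le_const[OF True, of B] integral_ge_const[OF True, of "- B"] by simp
next
  case False
  moreover have "0 \<le> B"
    using assms(2)[of undefined] by linarith
  ultimately show ?thesis
    by (simp add: not_integrable_integral_eq)
qed

text \<open>A kernel is controlled only on the space of \<open>L\<close>, while boundedness concerns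
  the whole type; \<open>space L = UNIV\<close> reconciles the two.\<close>

lemma bounded_measurable_integral_kernel:
  assumes f: "f \<in> bounded_measurable N" and \<kappa>: "\<kappa> \<in> L \<rightarrow>\<^sub>M prob_algebra N" and L: "space L = UNIV"
  shows "(\<lambda>x. integral\<^sup>L (\<kappa> x) f) \<in> bounded_measurable L"
proof -
  obtain B where B: "f \<in> borel_measurable N" "\<And>x. \<bar>f x\<bar> \<le> B"
    using f by (rule bounded_measurableE) blast
  show ?thesis
  proof (rule bounded_measurableI)
    show "(\<lambda>x. integral\<^sup>L (\<kappa> x) f) \<in> borel_measurable L"
      using measurable_compose[OF measurable_prob_algebraD[OF \<kappa>] integral_measurable_subprob_algebra[OF B(1)]] .
    fix x
    show "\<bar>integral\<^sup>L (\<kappa> x) f\<bar> \<le> B"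
      using measurable_space[OF \<kappa>, of x] L B(2) by (intro abs_integral_le_of_prob_algebra) auto
  qed
qed

text \<open>The tower property. Bind is the join of the image measure on measures, where the
  integral formula for bounded functions applies.\<close>

lemma integral_bind_bounded_measurable:
  assumes f: "f \<in> bounded_measurable N" and P: "P \<in> space (prob_algebra L)"
    and \<kappa>: "\<kappa> \<in> L \<rightarrow>\<^sub>M prob_algebra N"
  shows "integral\<^sup>L (P \<bind> \<kappa>) f = (\<integral>x. integral\<^sup>L (\<kappa> x) f \<partial>P)"
proof -
  obtain B where B: "f \<in> borel_measurable N" "\<And>x. \<bar>f x\<bar> \<le> B"
    using f by (rule bounded_measurableE) blast
  interpret prob_space P using P by (simp add: space_prob_algebra)
  have \<kappa>': "\<kappa> \<in> P \<rightarrow>\<^sub>M subprob_algebra N"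
    using measurable_prob_algebraD[OF \<kappa>] measurable_prob_algebra_cong[OF P] by auto
  interpret D: prob_space "distr P (subprob_algebra N) \<kappa>"
    by (rule prob_space_distr[OF \<kappa>'])
  have "integral\<^sup>L (P \<bind> \<kappa>) f = integral\<^sup>L (join (distr P (subprob_algebra N) \<kappa>)) f"
    by (simp add: bind_nonempty''[OF \<kappa>' not_empty])
  also have "\<dots> = (\<integral>Q. integral\<^sup>L Q f \<partial>distr P (subprob_algebra N) \<kappa>)"
  proof (rule integral_join[where B = B and B' = 1 and N = N])
    show "AE Q in distr P (subprob_algebra N) \<kappa>. emeasure Q (space Q) \<le> ennreal 1"
      by (rule AE_I2) (auto simp: space_subprob_algebra intro!: subprob_space.emeasure_space_le_1)
  qed (use B D.finite_measure_axioms in auto)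
  also have "\<dots> = (\<integral>x. integral\<^sup>L (\<kappa> x) f \<partial>P)"
    by (rule integral_distr[OF \<kappa>' integral_measurable_subprob_algebra[OF B(1)]])
  finally show ?thesis .
qed

text \<open>Fubini, with a point mass as outer measure.\<close>

lemma integral_return_pair:
  assumes f: "f \<in> bounded_measurable (L \<Otimes>\<^sub>M N)" and s: "s \<in> space L" and P: "P \<in> space (prob_algebra N)"
  shows "integral\<^sup>L (return L s \<Otimes>\<^sub>M P) f = (\<integral>x. f (s, x) \<partial>P)"
proof -
  interpret P: prob_space P using P by (simp add: space_prob_algebra)
  interpret R: prob_space "return L s" by (rule prob_space_return[OF s])
  interpret PR: pair_sigma_finite "return L s" P ..
  have sets: "sets P = sets N" using P by (simp add: space_prob_algebra)
  have "return L s \<in> space (prob_algebra L)"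
    by (simp add: space_prob_algebra R.prob_space_axioms)
  then have "return L s \<Otimes>\<^sub>M P \<in> space (prob_algebra (L \<Otimes>\<^sub>M N))"
    using P by (simp add: space_prob_algebra prob_space_pair sets cong: sets_pair_measure_cong)
  from integrable_bounded_measurable[OF f this]
  have "integral\<^sup>L (return L s \<Otimes>\<^sub>M P) f = (\<integral>t. \<integral>x. f (t, x) \<partial>P \<partial>return L s)"
    by (rule PR.integral_fst'[symmetric])
  also have "\<dots> = (\<integral>x. f (s, x) \<partial>P)"
  proof (rule integral_return[OF s])
    have "f \<in> borel_measurable (L \<Otimes>\<^sub>M N)" using f by (simp add: bounded_measurable_def)
    then have "f \<in> borel_measurable (L \<Otimes>\<^sub>M P)"
      using sets by (simp cong: measurable_cong_sets sets_pair_measure_cong)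
    then have [measurable]: "case_prod (\<lambda>t x. f (t, x)) \<in> borel_measurable (L \<Otimes>\<^sub>M P)"
      by simp
    show "(\<lambda>t. \<integral>x. f (t, x) \<partial>P) \<in> borel_measurable L"
      by (rule P.borel_measurable_lebesgue_integral) measurable
  qed
  finally show ?thesis .
qed

section \<open>Markov games with bounded rewards\<close>

lemma bind_assoc_prob_algebra:
  assumes P: "P \<in> space (prob_algebra L)"
    and f: "f \<in> L \<rightarrow>\<^sub>M prob_algebra N" and g: "g \<in> N \<rightarrow>\<^sub>M prob_algebra R"
  shows "(P \<bind> f) \<bind> g = P \<bind> (\<lambda>x. f x \<bind> g)"
  using measurable_prob_algebraD[OF f] measurable_prob_algebraD[OF g]
  by (intro bind_assoc) (auto simp only: measurable_prob_algebra_cong[OF P])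

lemma bind_in_prob_algebra:
  assumes P: "P \<in> space (prob_algebra L)" and f: "f \<in> L \<rightarrow>\<^sub>M prob_algebra N"
  shows "P \<bind> f \<in> space (prob_algebra N)"
  \<comment> \<open>The kernel rule is applied to a constant kernel and evaluated at an arbitrary
    point, which turns measurability into membership.\<close>
  using measurable_space[OF measurable_bind_prob_space[OF measurable_const[OF P] f], of undefined "count_space UNIV"]
  by simp

lemma pair_in_prob_algebra:
  assumes "P \<in> space (prob_algebra L)" "Q \<in> space (prob_algebra N)"
  shows "P \<Otimes>\<^sub>M Q \<in> space (prob_algebra (L \<Otimes>\<^sub>M N))"
  using measurable_space[OF measurable_pair_prob[OF measurable_const[OF assms(1)] measurable_const[OF assms(2)]],
      of undefined "count_space UNIV"]
  by simp

text \<open>At a saddle point \<open>u\<close> attains the infimum at \<open>m\<close>, and any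
  other \<open>u'\<close> has infimum at most its payoff against \<open>m\<close>. The bound on
  \<open>q\<close> is there because a real infimum is a lower bound only for sets bounded
  below.\<close>

lemma game_value_eq_saddle:
  assumes u: "u \<in> space (prob_algebra (max_actions M))" and m: "m \<in> space (prob_algebra (min_actions M))"
    and bound: "\<And>\<eta>. \<bar>q \<eta>\<bar> \<le> B"
    and max: "\<And>u'. u' \<in> space (prob_algebra (max_actions M)) \<Longrightarrow> payoff q s u' m \<le> payoff q s u m"
    and min: "\<And>m'. m' \<in> space (prob_algebra (min_actions M)) \<Longrightarrow> payoff q s u m \<le> payoff q s u m'"
  shows "game_value M q s = payoff q s u m"
proof -
  have payoff: "\<bar>payoff q s u' m'\<bar> \<le> B"
    if "u' \<in> space (prob_algebra (max_actions M))" "m' \<in> space (prob_algebra (min_actions M))" for u' m'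
    unfolding payoff_def using pair_in_prob_algebra[OF that] bound
    by (intro abs_integral_le_of_prob_algebra) auto
  have bdd: "bdd_below (payoff q s u' ` space (prob_algebra (min_actions M)))"
    if "u' \<in> space (prob_algebra (max_actions M))" for u'
  proof (rule bdd_belowI2[where m = "- B"])
    fix m' assume "m' \<in> space (prob_algebra (min_actions M))"
    from payoff[OF that this] show "- B \<le> payoff q s u' m'" by linarith
  qed
  have inf: "(INF m'\<in>space (prob_algebra (min_actions M)). payoff q s u m') = payoff q s u m"
    using m min by (intro cInf_eq_minimum) auto
  show ?thesis
    unfolding game_value_def
  proof (rule cSup_eq_maximum)
    show "payoff q s u m \<in> (\<lambda>u. INF m\<in>space (prob_algebra (min_actions M)). payoff q s u m) `
        space (prob_algebra (max_actions M))"
      using u inf by (intro image_eqI[where x = u]) auto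
    fix x assume "x \<in> (\<lambda>u. INF m\<in>space (prob_algebra (min_actions M)). payoff q s u m) `
        space (prob_algebra (max_actions M))"
    then obtain u' where u': "u' \<in> space (prob_algebra (max_actions M))"
        "x = (INF m'\<in>space (prob_algebra (min_actions M)). payoff q s u' m')"
      by auto
    have "x \<le> payoff q s u' m"
      unfolding u'(2) by (rule cINF_lower[OF bdd[OF u'(1)] m])
    also have "\<dots> \<le> payoff q s u m"
      by (rule max[OF u'(1)])
    finally show "x \<le> payoff q s u m" .
  qed
qed

text \<open>Applied at \<open>Suc h\<close> to a policy altered at stage \<open>h\<close> alone: the
  continuation values do not notice the deviation.\<close>

lemma V_pol_cong:
  assumes "\<And>h'. h \<le> h' \<Longrightarrow> \<upsilon> h' = \<upsilon>' h'" "\<And>h'. h \<le> h' \<Longrightarrow> \<mu> h' = \<mu>' h'"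
  shows "V_pol M \<upsilon> \<mu> h = V_pol M \<upsilon>' \<mu>' h"
proof -
  have turn: "turn_law M \<upsilon> \<mu> (h + n) = turn_law M \<upsilon>' \<mu>' (h + n)" for n
    using assms by (simp add: turn_law_def fun_eq_iff)
  have "state_law M \<upsilon> \<mu> h s n = state_law M \<upsilon>' \<mu>' h s n" for s n
    by (induction n) (simp_all add: turn)
  then show ?thesis
    by (simp add: V_pol_def eta_law_def turn fun_eq_iff)
qed

text \<open>\<open>markov_game\<close> restricts rewards only through totals from the initial state.
  Splitting expectations by linearity needs bounds at single stages; they are derived later from the
  bound on \<open>mg_loss\<close>.\<close>

locale bounded_markov_game =
  fixes M :: "('s, 'a, 'b) markov_game"
  assumes game: "markov_game M"
    and reward: "h \<in> {1..horizon M} \<Longrightarrow> reward M h \<in> bounded_measurable (turns M)"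
begin

lemma space_eq: "space (states M) = UNIV" "space (turns M) = UNIV"
  using game by (auto simp: markov_game_def space_pair_measure)

lemma trans_kernel: "h \<in> {1..horizon M} \<Longrightarrow> trans M h \<in> turns M \<rightarrow>\<^sub>M prob_algebra (states M)"
  using game by (auto simp: markov_game_def)

lemma trans_in_prob_algebra: "h \<in> {1..horizon M} \<Longrightarrow> trans M h \<eta> \<in> space (prob_algebra (states M))"
  using measurable_space[OF trans_kernel] by (simp add: space_eq)

text \<open>Point masses show that mixed actions exist, and for the zero payoff every pair is a
  saddle point.\<close>

lemma game_value_zero: "game_value M (\<lambda>_. 0) = (\<lambda>_. 0)"
proof
  fix s
  have "space (max_actions M) \<noteq> {}" "space (min_actions M) \<noteq> {}"
    using game by (auto simp: markov_game_def)
  then obtain u m where "u \<in> space (prob_algebra (max_actions M))" "m \<in> space (prob_algebra (min_actions M))"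
    using measurable_space[OF measurable_return_prob_space] by (metis ex_in_conv)
  then show "game_value M (\<lambda>_. 0) s = 0"
    using game_value_eq_saddle[of u M m "\<lambda>_. 0" 0 s] by (simp add: payoff_def split_def)
qed

section \<open>Laws and values under a fixed pair of policies\<close>

context
  fixes \<upsilon> \<mu>
  assumes policies: "\<upsilon> \<in> max_policies M" "\<mu> \<in> min_policies M"
begin

lemma policies_in_prob_algebra:
  assumes "h \<in> {1..horizon M}"
  shows "\<upsilon> h s \<in> space (prob_algebra (max_actions M))" "\<mu> h s \<in> space (prob_algebra (min_actions M))"
proof -
  have "\<upsilon> h \<in> states M \<rightarrow>\<^sub>M prob_algebra (max_actions M)" "\<mu> h \<in> states M \<rightarrow>\<^sub>M prob_algebra (min_actions M)"
    using assms policies by (auto simp: max_policies_def min_policies_def)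
  from this[THEN measurable_space, of s]
  show "\<upsilon> h s \<in> space (prob_algebra (max_actions M))" "\<mu> h s \<in> space (prob_algebra (min_actions M))"
    by (simp_all add: space_eq)
qed

lemma turn_law_kernel:
  assumes "h \<in> {1..horizon M}"
  shows "turn_law M \<upsilon> \<mu> h \<in> states M \<rightarrow>\<^sub>M prob_algebra (turns M)"
proof -
  have [measurable]: "\<upsilon> h \<in> states M \<rightarrow>\<^sub>M prob_algebra (max_actions M)"
    "\<mu> h \<in> states M \<rightarrow>\<^sub>M prob_algebra (min_actions M)"
    using assms policies by (auto simp: max_policies_def min_policies_def)
  have "(\<lambda>s. return (states M) s \<Otimes>\<^sub>M \<upsilon> h s \<Otimes>\<^sub>M \<mu> h s) \<in> states M \<rightarrow>\<^sub>M prob_algebra (turns M)"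
    by measurable
  then show ?thesis
    by (simp add: turn_law_def[abs_def])
qed

lemma turn_law_in_prob_algebra:
  "h \<in> {1..horizon M} \<Longrightarrow> turn_law M \<upsilon> \<mu> h s \<in> space (prob_algebra (turns M))"
  using measurable_space[OF turn_law_kernel] by (simp add: space_eq)

lemma integral_turn_law:
  assumes "h \<in> {1..horizon M}" "q \<in> bounded_measurable (turns M)"
  shows "integral\<^sup>L (turn_law M \<upsilon> \<mu> h s) q = payoff q s (\<upsilon> h s) (\<mu> h s)"
proof -
  have "(\<lambda>(a, b). q (s, a, b)) = (\<lambda>x. q (s, x))"
    by auto
  then show ?thesis
    unfolding turn_law_def payoff_def
    using integral_return_pair[OF assms(2) _ pair_in_prob_algebra[OF policies_in_prob_algebra[OF assms(1)]]]
    by (simp add: space_eq)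
qed

lemma state_law_kernel:
  assumes "1 \<le> h" "h + n \<le> Suc (horizon M)"
  shows "(\<lambda>s. state_law M \<upsilon> \<mu> h s n) \<in> states M \<rightarrow>\<^sub>M prob_algebra (states M)"
  using assms(2)
proof (induction n)
  case (Suc n)
  then have hn: "h + n \<in> {1..horizon M}" and "h + n \<le> Suc (horizon M)"
    using assms(1) by auto
  then show ?case
    using measurable_bind_prob_space[OF measurable_bind_prob_space[OF Suc.IH turn_law_kernel[OF hn]]
        trans_kernel[OF hn]]
    by simp
qed (simp add: measurable_return_prob_space)

lemma state_law_in_prob_algebra:
  "1 \<le> h \<Longrightarrow> h + n \<le> Suc (horizon M) \<Longrightarrow> state_law M \<upsilon> \<mu> h s n \<in> space (prob_algebra (states M))"
  using measurable_space[OF state_law_kernel] by (simp add: space_eq)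

lemma eta_law_kernel:
  assumes "1 \<le> h" "h + n \<le> horizon M"
  shows "(\<lambda>s. eta_law M \<upsilon> \<mu> h s n) \<in> states M \<rightarrow>\<^sub>M prob_algebra (turns M)"
  unfolding eta_law_def
  using assms by (intro measurable_bind_prob_space[OF state_law_kernel turn_law_kernel]) auto

lemma eta_law_in_prob_algebra:
  "1 \<le> h \<Longrightarrow> h + n \<le> horizon M \<Longrightarrow> eta_law M \<upsilon> \<mu> h s n \<in> space (prob_algebra (turns M))"
  using measurable_space[OF eta_law_kernel] by (simp add: space_eq)

lemma eta_law_0:
  assumes "h \<in> {1..horizon M}"
  shows "eta_law M \<upsilon> \<mu> h s 0 = turn_law M \<upsilon> \<mu> h s"
  using bind_return[OF measurable_prob_algebraD[OF turn_law_kernel[OF assms]]]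
  by (simp add: eta_law_def space_eq)

text \<open>\<open>state_law\<close> appends stages at the end, while the Bellman equation splits
  off the first one; associativity of bind converts one form into the other.\<close>

lemma state_law_Suc_shift:
  assumes "1 \<le> h" "h + n \<le> horizon M"
  shows "state_law M \<upsilon> \<mu> h s (Suc n) =
    (turn_law M \<upsilon> \<mu> h s \<bind> trans M h) \<bind> (\<lambda>s'. state_law M \<upsilon> \<mu> (Suc h) s' n)"
  using assms(2)
proof (induction n)
  case 0
  then have h: "h \<in> {1..horizon M}" using assms(1) by simp
  have "sets (turn_law M \<upsilon> \<mu> h s \<bind> trans M h) = sets (states M)"
    using bind_in_prob_algebra[OF turn_law_in_prob_algebra[OF h] trans_kernel[OF h]]
    by (simp add: space_prob_algebra)
  then show ?case
    using eta_law_0[OF h] by (simp add: eta_law_def bind_return'')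
next
  case (Suc n)
  then have h: "h \<in> {1..horizon M}" and h': "h + Suc n \<in> {1..horizon M}"
    using assms(1) by auto
  let ?P = "turn_law M \<upsilon> \<mu> h s \<bind> trans M h"
  let ?S = "\<lambda>s'. state_law M \<upsilon> \<mu> (Suc h) s' n"
  have P: "?P \<in> space (prob_algebra (states M))"
    by (rule bind_in_prob_algebra[OF turn_law_in_prob_algebra[OF h] trans_kernel[OF h]])
  have S: "?S \<in> states M \<rightarrow>\<^sub>M prob_algebra (states M)"
    using Suc.prems by (intro state_law_kernel) auto
  note turn = turn_law_kernel[OF h'] and tr = trans_kernel[OF h']
  have "state_law M \<upsilon> \<mu> h s (Suc (Suc n)) =
      ((?P \<bind> ?S) \<bind> turn_law M \<upsilon> \<mu> (h + Suc n)) \<bind> trans M (h + Suc n)"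
    using Suc by (simp only: state_law.simps(2)[of _ _ _ _ _ "Suc n"])
  also have "\<dots> = (?P \<bind> (\<lambda>s'. ?S s' \<bind> turn_law M \<upsilon> \<mu> (h + Suc n))) \<bind> trans M (h + Suc n)"
    by (simp only: bind_assoc_prob_algebra[OF P S turn])
  also have "\<dots> = ?P \<bind> (\<lambda>s'. (?S s' \<bind> turn_law M \<upsilon> \<mu> (h + Suc n)) \<bind> trans M (h + Suc n))"
    by (rule bind_assoc_prob_algebra[OF P measurable_bind_prob_space[OF S turn] tr])
  finally show ?case by simp
qed

lemma eta_law_Suc_shift:
  assumes "1 \<le> h" "h + Suc n \<le> horizon M"
  shows "eta_law M \<upsilon> \<mu> h s (Suc n) =
    (turn_law M \<upsilon> \<mu> h s \<bind> trans M h) \<bind> (\<lambda>s'. eta_law M \<upsilon> \<mu> (Suc h) s' n)"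
proof -
  have h: "h \<in> {1..horizon M}" and h': "h + Suc n \<in> {1..horizon M}"
    using assms by auto
  have "eta_law M \<upsilon> \<mu> h s (Suc n) =
      ((turn_law M \<upsilon> \<mu> h s \<bind> trans M h) \<bind> (\<lambda>s'. state_law M \<upsilon> \<mu> (Suc h) s' n))
        \<bind> turn_law M \<upsilon> \<mu> (h + Suc n)"
    unfolding eta_law_def using assms by (subst state_law_Suc_shift) auto
  also have "\<dots> = (turn_law M \<upsilon> \<mu> h s \<bind> trans M h) \<bind>
      (\<lambda>s'. state_law M \<upsilon> \<mu> (Suc h) s' n \<bind> turn_law M \<upsilon> \<mu> (h + Suc n))"
    using assms
    by (intro bind_assoc_prob_algebra[OF bind_in_prob_algebra[OF turn_law_in_prob_algebra[OF h] trans_kernel[OF h]]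
          state_law_kernel turn_law_kernel[OF h']]) auto
  finally show ?thesis
    by (simp add: eta_law_def)
qed

lemma V_pol_bounded_measurable:
  assumes "1 \<le> h"
  shows "V_pol M \<upsilon> \<mu> h \<in> bounded_measurable (states M)"
proof -
  have "(\<lambda>s. \<Sum>n<Suc (horizon M) - h. \<integral>\<eta>. reward M (h + n) \<eta> \<partial>eta_law M \<upsilon> \<mu> h s n)
      \<in> bounded_measurable (states M)"
    using assms
    by (intro bounded_measurable_sum bounded_measurable_integral_kernel[OF reward eta_law_kernel])
      (auto simp: space_eq)
  then show ?thesis
    by (simp add: V_pol_def[abs_def])
qed

lemma Q_pol_bounded_measurable:
  assumes "h \<in> {1..horizon M}"
  shows "Q_pol M \<upsilon> \<mu> h \<in> bounded_measurable (turns M)"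
  using bounded_measurable_add[OF reward[OF assms]
      bounded_measurable_integral_kernel[OF V_pol_bounded_measurable trans_kernel[OF assms]]]
  by (simp add: Q_pol_def[abs_def] space_eq)

text \<open>The Bellman equation of a pair of policies: the summand of stage \<open>h\<close> is
  split off, and the shift turns the others into the value from \<open>Suc h\<close>, averaged over
  the next state.\<close>

lemma V_pol_eq_payoff:
  assumes h: "h \<in> {1..horizon M}"
  shows "V_pol M \<upsilon> \<mu> h s = payoff (Q_pol M \<upsilon> \<mu> h) s (\<upsilon> h s) (\<mu> h s)"
proof -
  let ?T = "turn_law M \<upsilon> \<mu> h s"
  let ?P = "?T \<bind> trans M h"
  have T: "?T \<in> space (prob_algebra (turns M))"
    by (rule turn_law_in_prob_algebra[OF h])
  have P: "?P \<in> space (prob_algebra (states M))"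
    by (rule bind_in_prob_algebra[OF T trans_kernel[OF h]])
  have len: "Suc (horizon M) - h = Suc (horizon M - h)"
    using h by auto
  have bm: "(\<lambda>s'. \<integral>\<eta>. reward M (Suc h + n) \<eta> \<partial>eta_law M \<upsilon> \<mu> (Suc h) s' n) \<in> bounded_measurable (states M)"
    if "n < horizon M - h" for n
    using that h by (intro bounded_measurable_integral_kernel[OF reward eta_law_kernel]) (auto simp: space_eq)
  have "(\<integral>\<eta>. reward M (h + Suc n) \<eta> \<partial>eta_law M \<upsilon> \<mu> h s (Suc n)) =
      (\<integral>s'. \<integral>\<eta>. reward M (Suc h + n) \<eta> \<partial>eta_law M \<upsilon> \<mu> (Suc h) s' n \<partial>?P)" if "n < horizon M - h" for n
    using that h
    by (subst eta_law_Suc_shift)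
      (auto intro!: integral_bind_bounded_measurable[OF reward P eta_law_kernel, simplified])
  then have "V_pol M \<upsilon> \<mu> h s = (\<integral>\<eta>. reward M h \<eta> \<partial>?T) + (\<Sum>n<horizon M - h.
      \<integral>s'. \<integral>\<eta>. reward M (Suc h + n) \<eta> \<partial>eta_law M \<upsilon> \<mu> (Suc h) s' n \<partial>?P)"
    unfolding V_pol_def len sum.lessThan_Suc_shift using eta_law_0[OF h] by simp
  also have "(\<Sum>n<horizon M - h. \<integral>s'. \<integral>\<eta>. reward M (Suc h + n) \<eta> \<partial>eta_law M \<upsilon> \<mu> (Suc h) s' n \<partial>?P)
      = (\<integral>s'. V_pol M \<upsilon> \<mu> (Suc h) s' \<partial>?P)"
    unfolding V_pol_def diff_Suc_Suc
    by (rule Bochner_Integration.integral_sum[symmetric])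
      (use bm in \<open>auto intro: integrable_bounded_measurable[OF _ P]\<close>)
  also have "\<dots> = (\<integral>\<eta>. \<integral>s'. V_pol M \<upsilon> \<mu> (Suc h) s' \<partial>trans M h \<eta> \<partial>?T)"
    by (rule integral_bind_bounded_measurable[OF V_pol_bounded_measurable T trans_kernel[OF h]]) simp
  also have "(\<integral>\<eta>. reward M h \<eta> \<partial>?T) + \<dots> = (\<integral>\<eta>. Q_pol M \<upsilon> \<mu> h \<eta> \<partial>?T)"
    unfolding Q_pol_def
    by (rule Bochner_Integration.integral_add[symmetric])
      (auto intro!: integrable_bounded_measurable[OF _ T] reward[OF h]
        bounded_measurable_integral_kernel[OF V_pol_bounded_measurable trans_kernel[OF h]] simp: space_eq)
  also have "\<dots> = payoff (Q_pol M \<upsilon> \<mu> h) s (\<upsilon> h s) (\<mu> h s)"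
    by (rule integral_turn_law[OF h Q_pol_bounded_measurable[OF h]])
  finally show ?thesis .
qed

end

text \<open>
  Deviating at the single stage \<open>h\<close> to a fixed mixed action leaves the values after \<open>h\<close> unchanged, so a
  Nash equilibrium of the Markov game restricts to a saddle point of every stage game.
\<close>

lemma game_value_nash_Q:
  assumes nash: "nash_equilibrium M \<upsilon> \<mu>" and h: "h \<in> {1..horizon M}"
  shows "game_value M (Q_pol M \<upsilon> \<mu> h) s = V_pol M \<upsilon> \<mu> h s"
proof -
  have pol: "\<upsilon> \<in> max_policies M" "\<mu> \<in> min_policies M"
    and best_max: "\<And>\<upsilon>'. \<upsilon>' \<in> max_policies M \<Longrightarrow> V_pol M \<upsilon>' \<mu> h s \<le> V_pol M \<upsilon> \<mu> h s"
    and best_min: "\<And>\<mu>'. \<mu>' \<in> min_policies M \<Longrightarrow> V_pol M \<upsilon> \<mu> h s \<le> V_pol M \<upsilon> \<mu>' h s"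
    using nash h by (auto simp: nash_equilibrium_def)
  have V: "V_pol M \<upsilon> \<mu> h s = payoff (Q_pol M \<upsilon> \<mu> h) s (\<upsilon> h s) (\<mu> h s)"
    by (rule V_pol_eq_payoff[OF pol h])
  obtain B where B: "\<And>\<eta>. \<bar>Q_pol M \<upsilon> \<mu> h \<eta>\<bar> \<le> B"
    using Q_pol_bounded_measurable[OF pol h] by (rule bounded_measurableE) blast
  show ?thesis
    unfolding V
  proof (rule game_value_eq_saddle[OF policies_in_prob_algebra[OF pol h] B])
    fix u assume u: "u \<in> space (prob_algebra (max_actions M))"
    define \<upsilon>' where "\<upsilon>' = \<upsilon>(h := \<lambda>_. u)"
    have pol': "\<upsilon>' \<in> max_policies M"
      using pol(1) u by (auto simp: \<upsilon>'_def max_policies_def)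
    have "V_pol M \<upsilon>' \<mu> (Suc h) = V_pol M \<upsilon> \<mu> (Suc h)"
      by (rule V_pol_cong) (auto simp: \<upsilon>'_def)
    then have Q: "Q_pol M \<upsilon>' \<mu> h = Q_pol M \<upsilon> \<mu> h"
      by (simp add: Q_pol_def fun_eq_iff)
    show "payoff (Q_pol M \<upsilon> \<mu> h) s u (\<mu> h s) \<le> payoff (Q_pol M \<upsilon> \<mu> h) s (\<upsilon> h s) (\<mu> h s)"
      using best_max[OF pol'] V_pol_eq_payoff[OF pol' pol(2) h, of s] V
      \<comment> \<open>\<open>Q\<close> has to act first: once \<open>\<upsilon>'\<close> is
        unfolded, its left-hand side no longer occurs.\<close>
      by (simp add: Q) (simp add: \<upsilon>'_def)
  next
    fix m assume m: "m \<in> space (prob_algebra (min_actions M))"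
    define \<mu>' where "\<mu>' = \<mu>(h := \<lambda>_. m)"
    have pol': "\<mu>' \<in> min_policies M"
      using pol(2) m by (auto simp: \<mu>'_def min_policies_def)
    have "V_pol M \<upsilon> \<mu>' (Suc h) = V_pol M \<upsilon> \<mu> (Suc h)"
      by (rule V_pol_cong) (auto simp: \<mu>'_def)
    then have Q: "Q_pol M \<upsilon> \<mu>' h = Q_pol M \<upsilon> \<mu> h"
      by (simp add: Q_pol_def fun_eq_iff)
    show "payoff (Q_pol M \<upsilon> \<mu> h) s (\<upsilon> h s) (\<mu> h s) \<le> payoff (Q_pol M \<upsilon> \<mu> h) s (\<upsilon> h s) m"
      using best_min[OF pol'] V_pol_eq_payoff[OF pol(1) pol' h, of s] V
      by (simp add: Q) (simp add: \<mu>'_def)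
  qed
qed

lemma bellman_op_nash_Q:
  assumes "is_nash_Q M f" and off: "\<And>h. h \<notin> {1..horizon M} \<Longrightarrow> f h = (\<lambda>_. 0)"
  shows "bellman_op M f = f"
proof
  fix h
  from assms(1) obtain \<upsilon> \<mu> where nash: "nash_equilibrium M \<upsilon> \<mu>"
    and f: "\<And>h. h \<in> {1..horizon M} \<Longrightarrow> f h = Q_pol M \<upsilon> \<mu> h"
    by (auto simp: is_nash_Q_def)
  have "game_value M (f (Suc h)) s = V_pol M \<upsilon> \<mu> (Suc h) s" if "h \<in> {1..horizon M}" for s
  proof (cases "h = horizon M")
    \<comment> \<open>At stage \<open>horizon M + 1\<close> both sides are \<open>0\<close>:
      \<open>f\<close> vanishes there and the sum in \<open>V_pol\<close> is empty.\<close>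
    case True
    then show ?thesis
      by (simp add: off game_value_zero V_pol_def)
  next
    case False
    then show ?thesis
      using that f[of "Suc h"] by (simp add: game_value_nash_Q[OF nash])
  qed
  then have "game_value M (f (Suc h)) = V_pol M \<upsilon> \<mu> (Suc h)" if "h \<in> {1..horizon M}"
    using that by (simp add: fun_eq_iff)
  then show "bellman_op M f h = f h"
    using off[of h] f[of h] by (auto simp: bellman_op_def bellman_def[abs_def] Q_pol_def[abs_def])
qed

section \<open>Residuals along a trajectory against an arbitrary min-player\<close>

context
  fixes f \<upsilon> \<mu>'
  assumes f: "\<And>h. h \<in> {1..horizon M} \<Longrightarrow> f h \<in> bounded_measurable (turns M)"
    and f_end: "f (Suc (horizon M)) = (\<lambda>_. 0)"
    and pair: "nash_pair_of M f \<upsilon> \<mu>'"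
begin

lemma game_value_eq_payoff:
  assumes h: "h \<in> {1..horizon M}"
  shows "game_value M (f h) s = payoff (f h) s (\<upsilon> h s) (\<mu>' h s)"
proof -
  obtain B where B: "\<And>\<eta>. \<bar>f h \<eta>\<bar> \<le> B"
    using f[OF h] by (rule bounded_measurableE) blast
  show ?thesis
    using pair h
    by (intro game_value_eq_saddle[OF policies_in_prob_algebra[OF _ _ h] B])
      (auto simp: nash_pair_of_def)
qed

text \<open>The Nash pair consists of measurable policies, so the value of the stage game is the
  integral of \<open>f h\<close> against a kernel, which is measurable where the max-min formula
  shows nothing.\<close>

lemma game_value_bounded_measurable:
  assumes h: "h \<in> {1..Suc (horizon M)}"
  shows "game_value M (f h) \<in> bounded_measurable (states M)"
proof (cases "h = Suc (horizon M)")
  case True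
  have "game_value M (f h) = (\<lambda>_. 0)"
    by (simp add: True f_end game_value_zero)
  then show ?thesis
    by (simp add: bounded_measurable_const)
next
  case False
  then have h': "h \<in> {1..horizon M}" using h by auto
  have pol: "\<upsilon> \<in> max_policies M" "\<mu>' \<in> min_policies M"
    using pair by (auto simp: nash_pair_of_def)
  have "game_value M (f h) = (\<lambda>s. integral\<^sup>L (turn_law M \<upsilon> \<mu>' h s) (f h))"
    by (simp add: game_value_eq_payoff[OF h'] integral_turn_law[OF pol h' f[OF h']] fun_eq_iff)
  then show ?thesis
    using bounded_measurable_integral_kernel[OF f[OF h'] turn_law_kernel[OF pol h']]
    by (simp add: space_eq)
qed

lemma mean_est_mg_loss:
  assumes h: "h \<in> {1..horizon M}"
  shows "mean_est M (mg_loss M) h f' \<eta> f g = g h \<eta> - bellman M h (f (Suc h)) \<eta>"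
proof -
  interpret T: prob_space "trans M h \<eta>"
    using trans_in_prob_algebra[OF h] by (simp add: space_prob_algebra)
  have "integrable (trans M h \<eta>) (game_value M (f (Suc h)))"
    using h by (intro integrable_bounded_measurable[OF game_value_bounded_measurable trans_in_prob_algebra]) auto
  then show ?thesis
    by (simp add: mean_est_def mg_loss_def bellman_def T.prob_space)
qed

lemma residual_bounded_measurable:
  assumes h: "h \<in> {1..horizon M}"
  shows "residual M h f \<in> bounded_measurable (turns M)"
proof -
  have "(\<lambda>\<eta>. f h \<eta> - (reward M h \<eta> + (\<integral>s'. game_value M (f (Suc h)) s' \<partial>trans M h \<eta>)))
      \<in> bounded_measurable (turns M)"
    using h
    by (intro bounded_measurable_diff bounded_measurable_add f reward
        bounded_measurable_integral_kernel[OF game_value_bounded_measurable trans_kernel])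
      (auto simp: space_eq)
  then show ?thesis
    by (simp add: residual_def[abs_def] bellman_def)
qed

lemma regret_le_residuals:
  assumes \<mu>: "\<mu> \<in> min_policies M"
  shows "game_value M (f 1) s - V_pol M \<upsilon> \<mu> 1 s \<le>
    (\<Sum>h=1..horizon M. \<integral>\<eta>. \<bar>residual M h f \<eta>\<bar> \<partial>eta_law M \<upsilon> \<mu> 1 s (h - 1))"
proof -
  have pol: "\<upsilon> \<in> max_policies M" "\<mu> \<in> min_policies M"
    using pair \<mu> by (auto simp: nash_pair_of_def)
  let ?S = "state_law M \<upsilon> \<mu> 1 s" and ?E = "eta_law M \<upsilon> \<mu> 1 s"
  \<comment> \<open>The expected max-min value at stage \<open>n + 1\<close> when the max-player
    follows the Nash pair of \<open>f\<close> and the min-player follows the adversary's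
    \<open>\<mu>\<close>.\<close>
  define v where "v n = integral\<^sup>L (?S n) (game_value M (f (Suc n)))" for n
  have step: "v n - v (Suc n) \<le>
      (\<integral>\<eta>. \<bar>residual M (Suc n) f \<eta>\<bar> \<partial>?E n) + (\<integral>\<eta>. reward M (Suc n) \<eta> \<partial>?E n)"
    if n: "n < horizon M" for n
  proof -
    let ?h = "Suc n"
    let ?g = "\<lambda>\<eta>. \<integral>s'. game_value M (f (Suc ?h)) s' \<partial>trans M ?h \<eta>"
    have h: "?h \<in> {1..horizon M}" using n by auto
    have S: "?S n \<in> space (prob_algebra (states M))"
      using n by (intro state_law_in_prob_algebra[OF pol]) auto
    have E: "?E n \<in> space (prob_algebra (turns M))"
      using n by (intro eta_law_in_prob_algebra[OF pol]) auto
    have gv: "game_value M (f ?h) \<in> bounded_measurable (states M)"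
      "game_value M (f (Suc ?h)) \<in> bounded_measurable (states M)"
      using h by (auto intro!: game_value_bounded_measurable)
    have g: "?g \<in> bounded_measurable (turns M)"
      using bounded_measurable_integral_kernel[OF gv(2) trans_kernel[OF h]] by (simp add: space_eq)
    have "game_value M (f ?h) s' \<le> integral\<^sup>L (turn_law M \<upsilon> \<mu> ?h s') (f ?h)" for s'
    proof -
      have "payoff (f ?h) s' (\<upsilon> ?h s') (\<mu>' ?h s') \<le> payoff (f ?h) s' (\<upsilon> ?h s') (\<mu> ?h s')"
        using pair h policies_in_prob_algebra(2)[OF pol h] by (simp add: nash_pair_of_def)
      then show ?thesis
        by (simp add: game_value_eq_payoff[OF h] integral_turn_law[OF pol h f[OF h]])
    qed
    then have "v n \<le> (\<integral>s'. integral\<^sup>L (turn_law M \<upsilon> \<mu> ?h s') (f ?h) \<partial>?S n)"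
      unfolding v_def
      by (intro integral_mono integrable_bounded_measurable[OF gv(1) S]
          integrable_bounded_measurable[OF bounded_measurable_integral_kernel[OF f[OF h] turn_law_kernel[OF pol h]] S])
        (auto simp: space_eq)
    also have "\<dots> = integral\<^sup>L (?E n) (f ?h)"
      using integral_bind_bounded_measurable[OF f[OF h] S turn_law_kernel[OF pol h]]
      by (simp add: eta_law_def)
    \<comment> \<open>The definition of the residual read backwards: \<open>f\<close> is residual
      plus reward plus expected next value.\<close>
    also have "\<dots> = (\<integral>\<eta>. residual M ?h f \<eta> + reward M ?h \<eta> + ?g \<eta> \<partial>?E n)"
      by (simp add: residual_def bellman_def)
    also have "\<dots> = (\<integral>\<eta>. residual M ?h f \<eta> \<partial>?E n) + (\<integral>\<eta>. reward M ?h \<eta> \<partial>?E n) + integral\<^sup>L (?E n) ?g"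
      using integrable_bounded_measurable[OF residual_bounded_measurable[OF h] E]
        integrable_bounded_measurable[OF reward[OF h] E] integrable_bounded_measurable[OF g E]
      by simp
    also have "integral\<^sup>L (?E n) ?g = v (Suc n)"
      using integral_bind_bounded_measurable[OF gv(2) E trans_kernel[OF h]]
      by (simp add: v_def eta_law_def)
    also have "(\<integral>\<eta>. residual M ?h f \<eta> \<partial>?E n) \<le> (\<integral>\<eta>. \<bar>residual M ?h f \<eta>\<bar> \<partial>?E n)"
      using residual_bounded_measurable[OF h]
      by (intro integral_mono integrable_bounded_measurable[OF _ E] bounded_measurable_abs) auto
    finally show ?thesis by simp
  qed
  have "v 0 = game_value M (f 1) s"
    unfolding v_def using game_value_bounded_measurable[of 1]
    by (simp add: integral_return space_eq bounded_measurable_def)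
  \<comment> \<open>Index \<open>horizon M\<close> means stage \<open>horizon M + 1\<close>, where
    \<open>f\<close> is \<open>0\<close>; this closes the telescope.\<close>
  moreover have "v (horizon M) = 0"
    by (simp add: v_def f_end game_value_zero)
  ultimately have "game_value M (f 1) s = (\<Sum>n<horizon M. v n - v (Suc n))"
    by (simp add: sum_lessThan_telescope')
  also have "\<dots> \<le> (\<Sum>n<horizon M. (\<integral>\<eta>. \<bar>residual M (Suc n) f \<eta>\<bar> \<partial>?E n) + (\<integral>\<eta>. reward M (Suc n) \<eta> \<partial>?E n))"
    using step by (intro sum_mono) auto
  also have "\<dots> = (\<Sum>h=1..horizon M. \<integral>\<eta>. \<bar>residual M h f \<eta>\<bar> \<partial>?E (h - 1)) + V_pol M \<upsilon> \<mu> 1 s"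
    unfolding V_pol_def sum.distrib by (simp add: sum.atLeast1_atMost_eq)
  finally show ?thesis by simp
qed

end

end

section \<open>The Bellman estimation function\<close>

lemma est_boundD:
  assumes "est_bound M F G ell R" "h \<in> {1..horizon M}" "f' \<in> F" "f \<in> F" "g \<in> G"
  shows "norm (ell h f' \<zeta> \<eta> f g) \<le> R"
  using assms unfolding est_bound_def by blast

text \<open>
  The bound on the total reward says nothing about stage-1 rewards off the initial state; there the
  bound comes from the estimation function.
\<close>

lemma bounded_markov_game_of_est_bound:
  assumes game: "markov_game M" and bound: "est_bound M F G (mg_loss M) R"
    and f: "f \<in> F" "f \<in> G" "\<And>h. h \<in> {1..horizon M} \<Longrightarrow> f h \<in> bounded_measurable (turns M)"
  shows "bounded_markov_game M"
proof
  fix h assume h: "h \<in> {1..horizon M}"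
  obtain B where B: "\<And>\<eta>. \<bar>f h \<eta>\<bar> \<le> B"
    using f(3)[OF h] by (rule bounded_measurableE) blast
  \<comment> \<open>\<open>est_bound\<close> covers every next state, so an arbitrary fixed one
    serves.\<close>
  let ?v = "game_value M (f (Suc h)) undefined"
  show "reward M h \<in> bounded_measurable (turns M)"
  proof (rule bounded_measurableI[where B = "B + R + \<bar>?v\<bar>"])
    show "reward M h \<in> borel_measurable (turns M)"
      using game h by (simp add: markov_game_def)
    fix \<eta>
    have "\<bar>f h \<eta> - reward M h \<eta> - ?v\<bar> \<le> R"
      using est_boundD[OF bound h f(1,1,2)] by (simp add: mg_loss_def)
    with B[of \<eta>] show "\<bar>reward M h \<eta>\<bar> \<le> B + R + \<bar>?v\<bar>"
      by linarith
  qed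
qed (rule game)

text \<open>The constant is exhibited as \<open>ec_const R\<close>. It depends on \<open>R\<close>
  alone, which allows the final statement to choose it before the game, the classes and
  \<open>K\<close>.\<close>

lemma mg_loss_l2_EC_class:
  fixes \<Omega> :: "'w measure"
  assumes game: "markov_game M" and F: "F = prod_class M Fs" and G: "G = prod_class M Gs" and FG: "F \<subseteq> G"
    and action: "action_value_class M F"
    and pair: "\<forall>f\<in>F. nash_pair_of M f (\<upsilon>F f) (\<mu>F f)"
    and realizable: "realizable M F"
    and complete: "\<forall>h\<in>{1..horizon M}. \<forall>f\<in>F. bellman M h (f (Suc h)) \<in> Gs h"
    and bound: "est_bound M F G (mg_loss M) R"
    and \<Omega>: "prob_space \<Omega>"
    and K: "2 \<le> K" and d: "d = max 1 (minimax_BE_dim M F (1 / sqrt (real K)))"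
  shows "l2_EC_class (ec_const R) \<Omega> M \<upsilon>F F G (mg_loss M) R d 1 K \<and>
    decomposable M F G (mg_loss M) (bellman_op M) \<and>
    (\<forall>h\<in>{1..horizon M}. \<forall>\<beta>\<ge>R\<^sup>2. \<forall>fs \<eta>.
      (\<forall>i\<in>{1..K}. fs i \<in> F) \<longrightarrow>
      (\<forall>k\<in>{1..K}. (\<Sum>i=1..<k. (residual M h (fs k) (\<eta> i))\<^sup>2) \<le> \<beta>) \<longrightarrow>
      (\<forall>k\<in>{1..K}. ereal (\<Sum>i=1..k. (residual M h (fs i) (\<eta> i))\<^sup>2)
         \<le> ereal (ec_const R) * ereal_of_enat d * ereal \<beta> * ereal (ln (real K))))"
proof -
  have off: "f h = (\<lambda>_. 0)" if "f \<in> F" "h \<notin> {1..horizon M}" for f h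
    using that by (auto simp: F prod_class_def PiE_dflt_def)
  have bm: "f h \<in> bounded_measurable (turns M)" if "f \<in> F" "h \<in> {1..horizon M}" for f h
    using that action by (simp add: action_value_class_def bounded_measurable_def)
  have f_end: "f (Suc (horizon M)) = (\<lambda>_. 0)" if "f \<in> F" for f
    by (rule off[OF that]) simp
  \<comment> \<open>A member of \<open>F\<close> is what converts the bound on
    \<open>mg_loss\<close> into bounds on the rewards.\<close>
  obtain f0 where f0: "f0 \<in> F"
    using realizable by (auto simp: realizable_def)
  interpret bounded_markov_game M
    using bounded_markov_game_of_est_bound[OF game bound f0 _ bm[OF f0]] FG f0 by blast
  have mean: "mean_est M (mg_loss M) h f' \<eta> f g = g h \<eta> - bellman M h (f (Suc h)) \<eta>"
    if "f \<in> F" "h \<in> {1..horizon M}" for f' f g h \<eta>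
    using mean_est_mg_loss[OF bm[OF that(1)] f_end[OF that(1)] bspec[OF pair that(1)] that(2)] .
  \<comment> \<open>\<open>mg_loss\<close> is constant in \<open>f'\<close>. Hence the mixed terms
    of the EC condition, with \<open>fs i\<close> as index and \<open>fs k\<close> as argument, are
    residuals of \<open>fs k\<close> alone.\<close>
  have mean_residual: "mean_est M (mg_loss M) h f' \<eta> f f = residual M h f \<eta>"
    if "f \<in> F" "h \<in> {1..horizon M}" for f' f h \<eta>
    using mean[OF that] by (simp add: residual_def)
  have residual_bound: "\<bar>residual M h f \<eta>\<bar> \<le> R" if "f \<in> F" "h \<in> {1..horizon M}" for f h \<eta>
  proof -
    \<comment> \<open>The bound on the estimation function is used with \<open>g = f\<close>, which
      \<open>F \<subseteq> G\<close> permits, and is then averaged over the next state.\<close>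
    have "norm (mg_loss M h f \<zeta> \<eta> f f) \<le> R" for \<zeta>
      using that FG by (intro est_boundD[OF bound]) auto
    then have "\<bar>mean_est M (mg_loss M) h f \<eta> f f\<bar> \<le> R"
      unfolding mean_est_def
      by (intro abs_integral_le_of_prob_algebra[OF trans_in_prob_algebra[OF that(2)]])
        (simp flip: real_norm_def)
    then show ?thesis
      by (simp add: mean_residual[OF that])
  qed
  have sums: "ereal (\<Sum>i=1..k. (residual M h (fs i) (\<eta> i))\<^sup>2)
      \<le> ereal (ec_const R) * ereal_of_enat d * ereal \<beta> * ereal (ln (real K))"
    if "h \<in> {1..horizon M}" "R\<^sup>2 \<le> \<beta>" "\<forall>i\<in>{1..K}. fs i \<in> F" "k \<in> {1..K}"
      "\<forall>k\<in>{1..K}. (\<Sum>i=1..<k. (residual M h (fs k) (\<eta> i))\<^sup>2) \<le> \<beta>" for h \<beta> fs \<eta> k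
    using that by (intro residual_sum_le[OF that(1) K that(2) _ residual_bound _ _ d]) auto
  have "ec_condition (ec_const R) M F (mg_loss M) R d K"
    unfolding ec_condition_def
  proof (intro allI ballI impI)
    fix \<beta> h fs \<eta> k
    assume h: "h \<in> {1..horizon M}" and \<beta>: "R\<^sup>2 \<le> \<beta>" and fs: "\<forall>i\<in>{1..K}. fs i \<in> F" and k: "k \<in> {1..K}"
      and prefix_sums: "\<forall>k\<in>{1..K}.
        (\<Sum>i=1..<k. (norm (mean_est M (mg_loss M) h (fs i) (\<eta> i) (fs k) (fs k)))\<^sup>2) \<le> \<beta>"
    have "(\<Sum>i=1..k. (norm (mean_est M (mg_loss M) h (fs i) (\<eta> i) (fs i) (fs i)))\<^sup>2)
        = (\<Sum>i=1..k. (residual M h (fs i) (\<eta> i))\<^sup>2)"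
      using fs k h by (intro sum.cong) (auto simp: mean_residual)
    moreover have "\<forall>k\<in>{1..K}. (\<Sum>i=1..<k. (residual M h (fs k) (\<eta> i))\<^sup>2) \<le> \<beta>"
      using prefix_sums fs h by (simp add: mean_residual)
    ultimately show "ereal (\<Sum>i=1..k. (norm (mean_est M (mg_loss M) h (fs i) (\<eta> i) (fs i) (fs i)))\<^sup>2)
        \<le> ereal (ec_const R) * ereal_of_enat d * ereal \<beta> * ereal (ln (real K))"
      using sums[OF h \<beta> fs k] by simp
  qed
  moreover have "dominance \<Omega> M \<upsilon>F F (mg_loss M) 1 K"
    unfolding dominance_def
  proof (intro allI impI ballI)
    fix fs :: "nat \<Rightarrow> 'w \<Rightarrow> _" and \<mu>s \<delta> k
    assume in_F: "\<forall>i\<in>{1..K}. \<forall>\<omega>\<in>space \<Omega>. fs i \<omega> \<in> F \<and> \<mu>s i \<omega> \<in> min_policies M"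
      and \<delta>: "\<delta> \<in> {0<..<1 :: real}" and k: "k \<in> {1..K}"
    let ?regret = "\<lambda>i \<omega>. game_value M (fs i \<omega> 1) (init M) - V_pol M (\<upsilon>F (fs i \<omega>)) (\<mu>s i \<omega>) 1 (init M)"
    let ?est = "\<lambda>h i \<omega>. \<integral>\<eta>. norm (mean_est M (mg_loss M) h (fs i \<omega>) \<eta> (fs i \<omega>) (fs i \<omega>))
        \<partial>eta_law M (\<upsilon>F (fs i \<omega>)) (\<mu>s i \<omega>) 1 (init M) (h - 1)"
    have "(\<Sum>i=1..k. ?regret i \<omega>) \<le> 1 * (\<Sum>h=1..horizon M. \<Sum>i=1..k. ?est h i \<omega>)" if \<omega>: "\<omega> \<in> space \<Omega>" for \<omega>
    proof -
      have "?regret i \<omega> \<le> (\<Sum>h=1..horizon M. ?est h i \<omega>)" if "i \<in> {1..k}" for i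
      proof -
        have i: "fs i \<omega> \<in> F" "\<mu>s i \<omega> \<in> min_policies M"
          using in_F \<omega> that k by auto
        have "?regret i \<omega> \<le> (\<Sum>h=1..horizon M. \<integral>\<eta>. \<bar>residual M h (fs i \<omega>) \<eta>\<bar>
            \<partial>eta_law M (\<upsilon>F (fs i \<omega>)) (\<mu>s i \<omega>) 1 (init M) (h - 1))"
          by (rule regret_le_residuals[OF bm[OF i(1)] f_end[OF i(1)] bspec[OF pair i(1)] i(2)])
        also have "\<dots> = (\<Sum>h=1..horizon M. ?est h i \<omega>)"
          by (rule sum.cong) (simp_all add: mean_residual[OF i(1)])
        finally show ?thesis .
      qed
      then have "(\<Sum>i=1..k. ?regret i \<omega>) \<le> (\<Sum>i=1..k. \<Sum>h=1..horizon M. ?est h i \<omega>)"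
        by (rule sum_mono)
      also have "\<dots> = (\<Sum>h=1..horizon M. \<Sum>i=1..k. ?est h i \<omega>)"
        by (rule sum.swap)
      finally show ?thesis by simp
    qed
    then show "\<exists>A\<in>sets \<Omega>. measure \<Omega> A \<ge> 1 - \<delta> \<and>
        (\<forall>\<omega>\<in>A. (\<Sum>i=1..k. ?regret i \<omega>) \<le> 1 * (\<Sum>h=1..horizon M. \<Sum>i=1..k. ?est h i \<omega>))"
      using prob_space.prob_space[OF \<Omega>] \<delta> by (intro bexI[of _ "space \<Omega>"]) auto
  qed
  moreover have "decomposable M F G (mg_loss M) (bellman_op M)"
    unfolding decomposable_def
  proof (intro conjI ballI allI impI)
    \<comment> \<open>Completeness handles the stages of the game; at all others
      \<open>bellman_op\<close> is \<open>0\<close>, as \<open>prod_class\<close> requires.\<close>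
    show "bellman_op M \<in> F \<rightarrow> G"
      using complete by (auto simp: G prod_class_def PiE_dflt_def bellman_op_def)
    show "bellman_op M f = f" if "f \<in> F" "is_nash_Q M f" for f
      by (rule bellman_op_nash_Q[OF that(2) off[OF that(1)]])
    \<comment> \<open>\<open>g\<close> enters only through \<open>g h \<eta>\<close>, which cancels;
      the mean leaves the Bellman backup of \<open>f\<close> in its place.\<close>
    show "mg_loss M h f' \<zeta> \<eta> f g - mean_est M (mg_loss M) h f' \<eta> f g = mg_loss M h f' \<zeta> \<eta> f (bellman_op M f)"
      if "h \<in> {1..horizon M}" "f \<in> F" for h f' f g \<zeta> \<eta>
      using that(1) by (simp add: mean[OF that(2,1)] mg_loss_def bellman_op_def)
  qed
  ultimately show ?thesis
    unfolding l2_EC_class_def using FG realizable bound sums by blast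
qed

theorem lemmaE2:
  shows "\<exists>C :: real \<Rightarrow> real. (\<forall>R. 0 < C R) \<and>
    (\<forall>(M :: ('s, 'a, 'b) markov_game) Fs Gs F G \<upsilon>F \<mu>F (\<Omega> :: 'w measure) R K d.
       markov_game M \<longrightarrow>
       F = prod_class M Fs \<longrightarrow> G = prod_class M Gs \<longrightarrow> F \<subseteq> G \<longrightarrow>
       action_value_class M F \<longrightarrow>
       (\<forall>f\<in>F. nash_pair_of M f (\<upsilon>F f) (\<mu>F f)) \<longrightarrow>
       realizable M F \<longrightarrow>
       (\<forall>h\<in>{1..horizon M}. \<forall>f\<in>F. bellman M h (f (Suc h)) \<in> Gs h) \<longrightarrow>
       est_bound M F G (mg_loss M) R \<longrightarrow>
       prob_space \<Omega> \<longrightarrow>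
       2 \<le> K \<longrightarrow>
       d = max 1 (minimax_BE_dim M F (1 / sqrt (real K))) \<longrightarrow>
       l2_EC_class (C R) \<Omega> M \<upsilon>F F G (mg_loss M) R d 1 K \<and>
       decomposable M F G (mg_loss M) (bellman_op M) \<and>
       (\<forall>h\<in>{1..horizon M}. \<forall>\<beta>\<ge>R\<^sup>2. \<forall>fs \<eta>.
          (\<forall>i\<in>{1..K}. fs i \<in> F) \<longrightarrow>
          (\<forall>k\<in>{1..K}. (\<Sum>i=1..<k. (residual M h (fs k) (\<eta> i))\<^sup>2) \<le> \<beta>) \<longrightarrow>
          (\<forall>k\<in>{1..K}. ereal (\<Sum>i=1..k. (residual M h (fs i) (\<eta> i))\<^sup>2)
             \<le> ereal (C R) * ereal_of_enat d * ereal \<beta> * ereal (ln (real K)))))"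
proof (rule exI[of _ ec_const], rule conjI)
  show "\<forall>R. 0 < ec_const R"
    by (simp add: ec_const_pos)
qed (intro allI impI, rule mg_loss_l2_EC_class)

end
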